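(* Fix $0<k<1$ and let $F(a,b;c;z)={}_2F_1(a,b;c;z)$ denote the Gauss hypergeometric function. For $\phi$ in a neighbourhood of $0$ set $$u(\phi)=\int_0^{\sin\phi} F\!\left(\tfrac13,\tfrac23;\tfrac12;k^2t^2\right)\frac{\mathrm{d}t}{\sqrt{1-t^2}},$$ so that $\frac{\mathrm{d}u}{\mathrm{d}\phi}=F(\tfrac13,\tfrac23;\tfrac12;k^2\sin^2\phi)$. On a connected neighbourhood of the origin, invert $\phi\mapsto u$ to obtain $u\mapsto\phi(u)$ with $\phi(0)=0$, and define $$d(u)=\phi'(u)=\frac{1}{F\!\left(\tfrac13,\tfrac23;\tfrac12;k^2\sin^2\phi(u)\right)}.$$ Let $\wp$ be the Weierstrass elliptic function with invariants $$g_2=\tfrac{4}{27}(9-8k^2),\qquad g_3=\tfrac{8}{27^2}(8k^4-36k^2+27).$$ Then $d$ extends to (i.e. coincides near $0$ with) the function $$d=1-\tfrac49 k^2\left(\wp+\tfrac13\right)^{-1}.$$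
   Context: $\wp$ denotes the Weierstrass $\wp$-function satisfying $(\wp')^2=4\wp^3-g_2\wp-g_3$ with a double pole at $0$ (and at the lattice points) with principal part $u^{-2}$. *)

theory Defs
  imports "HOL-Analysis.Analysis"
begin

definition hyp2F1 :: "real \<Rightarrow> real \<Rightarrow> real \<Rightarrow> real \<Rightarrow> real" where
  "hyp2F1 a b c z =
     (\<Sum>n. pochhammer a n * pochhammer b n / (pochhammer c n * fact n) * z ^ n)"

definition lattice :: "complex \<Rightarrow> complex \<Rightarrow> complex set" where
  "lattice w1 w2 = {of_int m * w1 + of_int n * w2 | m n. True}"

definition wp :: "complex \<Rightarrow> complex \<Rightarrow> complex \<Rightarrow> complex" where
  "wp w1 w2 z = 1 / z ^ 2 +
     infsum (\<lambda>w. 1 / (z - w) ^ 2 - 1 / w ^ 2) (lattice w1 w2 - {0})"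

definition inv_g2 :: "complex \<Rightarrow> complex \<Rightarrow> complex" where
  "inv_g2 w1 w2 = 60 * infsum (\<lambda>w. 1 / w ^ 4) (lattice w1 w2 - {0})"

definition inv_g3 :: "complex \<Rightarrow> complex \<Rightarrow> complex" where
  "inv_g3 w1 w2 = 140 * infsum (\<lambda>w. 1 / w ^ 6) (lattice w1 w2 - {0})"

end

theory Submission
  imports Defs "HOL-Complex_Analysis.Complex_Analysis"
begin

text \<open>
  With \<open>k sin \<phi> = sin \<psi>\<close> the hypergeometric function becomes elementary,
  \<open>F(1/3,2/3;1/2;sin\<^sup>2 \<psi>) = cos (\<psi>/3) / cos \<psi>\<close>, so that \<open>d = 1 - 4 s\<^sup>2\<close> for \<open>s = sin (\<psi>/3)\<close>,
  and the triplication formula for the sine turns \<open>u\<close> into the integral from \<open>0\<close> to \<open>s\<close> of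
  \<open>3 / sqrt (k\<^sup>2 - \<sigma>\<^sup>2 (3 - 4 \<sigma>\<^sup>2)\<^sup>2) d\<sigma>\<close>. By the differential equation of the Weierstrass function, the
  holomorphic germ \<open>S = (k/3) / sqrt (wp + 1/3)\<close> inverts the same integral. The integral
  is injective near \<open>0\<close> as a function of a complex variable, whence \<open>s = S(u)\<close>; in particular the reality of
  \<open>wp\<close> on the real axis, which is not evident since the lattice need not be
  stable under conjugation, never has to be addressed.
\<close>

section \<open>The cubic hypergeometric function\<close>

text \<open>The invariants and the shift 1/3 come from one computation. For P = wp + 1/3 the
  Weierstrass equation reads P'^2 = 4 P^3 - 4 P^2 + (32/27) k^2 P - (64/729) k^4, and P = k^2 / (9
  s^2) turns it into 9 s'^2 = k^2 - s^2 (3 - 4 s^2)^2. The radicand has degree six in s but is a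
  cubic in s^2, which is why s^2, and with it d, is an elliptic function of u; 1 - 4 s^2 becomes 1 -
  (4/9) k^2 / P. Since \<open>wp\<close> and its invariants are given as bare lattice sums, most of
  the length goes into deriving the differential equation from these sums: the error in it is shown
  to be an entire, doubly periodic function that vanishes at 0.\<close>

definition cubic_coeff :: "nat \<Rightarrow> real" where
  "cubic_coeff n = pochhammer (1/3) n * pochhammer (2/3) n / (pochhammer (1/2) n * fact n)"

lemma cubic_coeff_0 [simp]: "cubic_coeff 0 = 1"
  by (simp add: cubic_coeff_def)

lemma cubic_coeff_Suc:
  "cubic_coeff (Suc n) = cubic_coeff n * ((1/3 + real n) * (2/3 + real n) / ((1/2 + real n) * (1 + real n)))"
  unfolding cubic_coeff_def pochhammer_Suc fact_Suc
  by (simp only: times_divide_times_eq of_nat_mult of_nat_Suc mult_ac add_ac)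

lemma cubic_coeff_Suc':
  "(1/2 + real n) * (1 + real n) * cubic_coeff (Suc n) = (1/3 + real n) * (2/3 + real n) * cubic_coeff n"
proof -
  have "(1/2 + real n) * (1 + real n) \<noteq> 0"
    by (metis add_pos_nonneg less_irrefl mult_eq_0_iff of_nat_0_le_iff zero_less_divide_1_iff zero_less_numeral zero_less_one)
  then show ?thesis unfolding cubic_coeff_Suc by (simp add: mult.commute)
qed

text \<open>The ratio of consecutive coefficients is (n^2 + n + 2/9) / (n^2 + 3n/2 + 1/2), at most
  1. This crude bound already gives convergence in the open unit disc.\<close>

lemma cubic_coeff_bounds: "0 \<le> cubic_coeff n \<and> cubic_coeff n \<le> 1"
proof (induction n)
  case (Suc n)
  have "0 \<le> (1/3 + real n) * (2/3 + real n) / ((1/2 + real n) * (1 + real n))" by simp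
  moreover have "(1/3 + real n) * (2/3 + real n) \<le> (1/2 + real n) * (1 + real n)"
    by (simp add: algebra_simps)
  then have "(1/3 + real n) * (2/3 + real n) / ((1/2 + real n) * (1 + real n)) \<le> 1"
    by (intro divide_le_eq_1[THEN iffD2]) (auto intro!: mult_pos_pos)
  ultimately show ?case unfolding cubic_coeff_Suc using Suc
    by (intro conjI mult_nonneg_nonneg mult_le_one) auto
qed simp

definition cubic_fps :: "real fps" where "cubic_fps = Abs_fps cubic_coeff"

lemma hyp2F1_eq_eval_fps: "hyp2F1 (1/3) (2/3) (1/2) z = eval_fps cubic_fps z"
  by (simp add: hyp2F1_def eval_fps_def cubic_fps_def cubic_coeff_def)

lemma conv_radius_cubic_fps: "fps_conv_radius cubic_fps \<ge> 1"
  unfolding fps_conv_radius_def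
proof (rule conv_radius_geI_ex')
  fix r :: real assume r: "0 < r" "ereal r < 1"
  show "summable (\<lambda>n. fps_nth cubic_fps n * of_real r ^ n)"
  proof (rule summable_comparison_test)
    show "summable (\<lambda>n. r ^ n)" using r by (intro summable_geometric) auto
    have "\<bar>cubic_coeff n\<bar> * r ^ n \<le> r ^ n" for n
      using cubic_coeff_bounds[of n] r by (intro mult_left_le_one_le) auto
    then show "\<exists>N. \<forall>n\<ge>N. norm (fps_nth cubic_fps n * of_real r ^ n) \<le> r ^ n"
      using r by (auto simp: cubic_fps_def abs_mult)
  qed
qed

text \<open>Gauss's equation z (1 - z) F'' + (c - (a + b + 1) z) F' = a b F with a + b + 1 = 2, c =
  1/2 and a b = 2/9. Coefficient by coefficient it is the two-term recurrence
  \<open>cubic_coeff_Suc'\<close>.\<close>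

lemma cubic_fps_ode:
  "fps_X * ((1 - fps_X) * fps_deriv (fps_deriv cubic_fps)) + (fps_const (1/2) - fps_const 2 * fps_X) * fps_deriv cubic_fps
     = fps_const (2/9) * cubic_fps"
proof (rule fps_ext)
  fix n :: nat
  show "fps_nth (fps_X * ((1 - fps_X) * fps_deriv (fps_deriv cubic_fps)) + (fps_const (1/2) - fps_const 2 * fps_X) * fps_deriv cubic_fps) n
     = fps_nth (fps_const (2/9) * cubic_fps) n"
  proof (cases n)
    case 0
    then show ?thesis using cubic_coeff_Suc'[of 0] by (simp add: cubic_fps_def fps_mult_nth)
  next
    case (Suc m)
    have e: "fps_X * ((1 - fps_X) * fps_deriv (fps_deriv cubic_fps)) + (fps_const (1/2) - fps_const 2 * fps_X) * fps_deriv cubic_fps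
      = fps_X * fps_deriv (fps_deriv cubic_fps) - fps_X * (fps_X * fps_deriv (fps_deriv cubic_fps))
        + fps_const (1/2) * fps_deriv cubic_fps - fps_const 2 * (fps_X * fps_deriv cubic_fps)"
      by (simp add: algebra_simps)
    have "fps_nth (fps_X * ((1 - fps_X) * fps_deriv (fps_deriv cubic_fps)) + (fps_const (1/2) - fps_const 2 * fps_X) * fps_deriv cubic_fps) n
       - fps_nth (fps_const (2/9) * cubic_fps) n
      = (1/2 + real n) * (1 + real n) * cubic_coeff (Suc n) - (1/3 + real n) * (2/3 + real n) * cubic_coeff n"
      unfolding e by (cases m) (simp_all add: Suc cubic_fps_def field_simps)
    then show ?thesis using cubic_coeff_Suc'[of n] by simp
  qed
qed

text \<open>Passing to z = sin^2 y and multiplying by cos y removes the first-order term from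
  Gauss's equation. What remains is a harmonic oscillator of frequency 1/3 with initial values 1 and
  0.\<close>

lemma hyp2F1_cubic_trig:
  assumes y: "\<bar>y\<bar> < pi / 2"
  shows "hyp2F1 (1/3) (2/3) (1/2) ((sin y)\<^sup>2) = cos (y / 3) / cos y"
proof -
  define f where "f = eval_fps cubic_fps"
  define f1 where "f1 = eval_fps (fps_deriv cubic_fps)"
  define f2 where "f2 = eval_fps (fps_deriv (fps_deriv cubic_fps))"
  have rad: "ereal (norm z) < fps_conv_radius cubic_fps" "ereal (norm z) < fps_conv_radius (fps_deriv cubic_fps)"
     "ereal (norm z) < fps_conv_radius (fps_deriv (fps_deriv cubic_fps))" if "norm z < 1" for z :: real
  proof -
    have "ereal (norm z) < 1" using that by simp
    then show "ereal (norm z) < fps_conv_radius cubic_fps" 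
      using conv_radius_cubic_fps by (rule less_le_trans)
    then show "ereal (norm z) < fps_conv_radius (fps_deriv cubic_fps)"
      using fps_conv_radius_deriv by (rule less_le_trans)
    then show "ereal (norm z) < fps_conv_radius (fps_deriv (fps_deriv cubic_fps))"
      using fps_conv_radius_deriv by (rule less_le_trans)
  qed
  have df: "(f has_field_derivative f1 z) (at z)" and df1: "(f1 has_field_derivative f2 z) (at z)"
    if "\<bar>z\<bar> < 1" for z
    unfolding f_def f1_def f2_def using rad[of z] that by (auto intro!: has_field_derivative_eval_fps)
  have ode: "z * ((1 - z) * f2 z) + (1/2 - 2 * z) * f1 z = 2/9 * f z" if z: "\<bar>z\<bar> < 1" for z
  proof -
    define D1 where "D1 = fps_deriv cubic_fps"
    define D2 where "D2 = fps_deriv (fps_deriv cubic_fps)"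
    note r = rad[of z, folded D1_def D2_def]
    have r1: "ereal (norm z) < fps_conv_radius (1 - fps_X :: real fps)"
      by (rule less_le_trans[OF _ fps_conv_radius_diff]) simp
    have r2: "ereal (norm z) < fps_conv_radius ((1 - fps_X) * D2)"
      by (rule less_le_trans[OF _ fps_conv_radius_mult]) (use r r1 z in simp)
    have r3: "ereal (norm z) < fps_conv_radius (fps_X * ((1 - fps_X) * D2))"
      by (rule less_le_trans[OF _ fps_conv_radius_mult]) (use r2 z in simp)
    have r4: "ereal (norm z) < fps_conv_radius (fps_const 2 * fps_X :: real fps)"
      by (rule less_le_trans[OF _ fps_conv_radius_mult]) simp
    have r5: "ereal (norm z) < fps_conv_radius (fps_const (1/2) - fps_const 2 * fps_X :: real fps)"
      by (rule less_le_trans[OF _ fps_conv_radius_diff]) (use r4 in simp)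
    have r6: "ereal (norm z) < fps_conv_radius ((fps_const (1/2) - fps_const 2 * fps_X) * D1)"
      by (rule less_le_trans[OF _ fps_conv_radius_mult]) (use r r5 z in simp)
    have "eval_fps (fps_X * ((1 - fps_X) * D2) + (fps_const (1/2) - fps_const 2 * fps_X) * D1) z
       = eval_fps (fps_const (2/9) * cubic_fps) z"
      unfolding D1_def D2_def by (rule arg_cong[OF cubic_fps_ode])
    moreover have "f1 z = eval_fps D1 z" "f2 z = eval_fps D2 z" by (simp_all add: f1_def f2_def D1_def D2_def)
    ultimately show ?thesis
      using r r1 r2 r3 r4 r5 r6 z
      by (simp add: f_def eval_fps_add eval_fps_mult eval_fps_diff)
  qed
  \<comment> \<open>The hypergeometric equation becomes \<open>w'' = - w / 9\<close>; \<open>A\<close> and \<open>B\<close> below are first integrals of it.\<close>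
  define w where "w = (\<lambda>y. f ((sin y)\<^sup>2) * cos y)"
  define w' where "w' = (\<lambda>y. 2 * sin y * (cos y)\<^sup>2 * f1 ((sin y)\<^sup>2) - sin y * f ((sin y)\<^sup>2))"
  define I where "I = {-pi/2<..<pi/2}"
  have sin2: "\<bar>(sin y)\<^sup>2\<bar> < 1" if "y \<in> I" for y
  proof -
    have "cos y > 0" using that by (intro cos_gt_zero_pi) (auto simp: I_def)
    then show ?thesis using sin_cos_squared_add[of y] by (smt (verit) zero_less_power zero_le_power2)
  qed
  have dfs: "((\<lambda>y. f ((sin y)\<^sup>2)) has_field_derivative f1 ((sin y)\<^sup>2) * (2 * sin y * cos y)) (at y)" if "y \<in> I" for y
    by (rule DERIV_chain2[where f = f, OF df], use sin2[OF that] in simp)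
      (auto intro!: derivative_eq_intros)
  have dfs1: "((\<lambda>y. f1 ((sin y)\<^sup>2)) has_field_derivative f2 ((sin y)\<^sup>2) * (2 * sin y * cos y)) (at y)" if "y \<in> I" for y
    by (rule DERIV_chain2[where f = f1, OF df1], use sin2[OF that] in simp)
      (auto intro!: derivative_eq_intros)
  have dw: "(w has_field_derivative w' y) (at y)" if "y \<in> I" for y
    unfolding w_def w'_def
    by (rule DERIV_cong, (rule dfs that derivative_eq_intros refl)+) (simp add: power2_eq_square algebra_simps)
  have dw': "(w' has_field_derivative - w y / 9) (at y)" if "y \<in> I" for y
  proof -
    define z where "z = (sin y)\<^sup>2"
    have c: "(cos y)\<^sup>2 = 1 - z" by (simp add: z_def cos_squared_eq)
    have "(w' has_field_derivative 4 * (sin y)\<^sup>2 * (cos y * (cos y)\<^sup>2) * f2 z + (2 * (cos y * (cos y)\<^sup>2) - 6 * (sin y)\<^sup>2 * cos y) * f1 z - cos y * f z) (at y)"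
      unfolding w'_def z_def
      by (rule DERIV_cong, (rule dfs dfs1 that derivative_eq_intros refl)+) (simp add: power2_eq_square algebra_simps)
    also have "4 * (sin y)\<^sup>2 * (cos y * (cos y)\<^sup>2) * f2 z + (2 * (cos y * (cos y)\<^sup>2) - 6 * (sin y)\<^sup>2 * cos y) * f1 z - cos y * f z
      = 4 * cos y * (z * ((1 - z) * f2 z) + (1/2 - 2 * z) * f1 z - f z / 4)"
      unfolding c z_def[symmetric] by (simp add: algebra_simps)
    \<comment> \<open>Gauss's equation makes the bracket (2/9 - 1/4) f z = - f z / 36; the factor 4
      leaves -1/9.\<close>
    also have "\<dots> = - w y / 9"
      using ode[OF sin2[OF that], folded z_def] by (simp only: w_def z_def[symmetric]) simp
    finally show ?thesis .
  qed
  have 0: "0 \<in> I" and yI: "y \<in> I" using y by (auto simp: I_def)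
  have conv: "convex I" by (simp add: I_def)
  define A where "A = (\<lambda>y. w y * cos (y/3) - 3 * w' y * sin (y/3))"
  define B where "B = (\<lambda>y. w y * sin (y/3) + 3 * w' y * cos (y/3))"
  have "(A has_field_derivative 0) (at y within I)" if "y \<in> I" for y
    unfolding A_def
    by (rule has_field_derivative_at_within, rule DERIV_cong, (rule dw dw' that derivative_eq_intros refl zero_neq_numeral[symmetric])+) (simp add: algebra_simps)
  then have "A y = A 0" using has_field_derivative_zero_constant[OF conv, of A] 0 yI by metis
  moreover have "(B has_field_derivative 0) (at y within I)" if "y \<in> I" for y
    unfolding B_def
    by (rule has_field_derivative_at_within, rule DERIV_cong, (rule dw dw' that derivative_eq_intros refl zero_neq_numeral[symmetric])+) (simp add: algebra_simps)
  then have "B y = B 0" using has_field_derivative_zero_constant[OF conv, of B] 0 yI by metis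
  moreover have "f 0 = 1" by (simp add: f_def eval_fps_at_0 cubic_fps_def)
  ultimately have AB: "w y * cos (y/3) - 3 * w' y * sin (y/3) = 1" "w y * sin (y/3) + 3 * w' y * cos (y/3) = 0"
    by (auto simp: A_def B_def w_def w'_def)
  have "w y = w y * ((cos (y/3))\<^sup>2 + (sin (y/3))\<^sup>2)" by simp
  \<comment> \<open>Rotating back by the angle y/3 recovers \<open>w\<close> from the constants A =
    1 and B = 0.\<close>
  also have "\<dots> = cos (y/3) * (w y * cos (y/3) - 3 * w' y * sin (y/3)) + sin (y/3) * (w y * sin (y/3) + 3 * w' y * cos (y/3))"
    by algebra
  finally have "w y = cos (y/3)" unfolding AB by simp
  moreover have "cos y > 0" using y by (intro cos_gt_zero_pi) auto
  ultimately show ?thesis by (simp add: hyp2F1_eq_eval_fps f_def[symmetric] w_def field_simps)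
qed

section \<open>Lattice sums\<close>

text \<open>The exponent 3 of the norm of a lattice point will be shared evenly between two
  coordinates, and 3/2 still exceeds 1.\<close>

lemma summable_on_int_powr: "(\<lambda>m::int. (1 + \<bar>real_of_int m\<bar>) powr (-3/2)) summable_on UNIV"
proof -
  let ?f = "\<lambda>m::int. (1 + \<bar>real_of_int m\<bar>) powr (-3/2)"
  have "summable (\<lambda>n. real n powr (-3/2))" by (simp add: summable_real_powr_iff)
  then have "summable (\<lambda>n. real (Suc n) powr (-3/2))" by (subst summable_Suc_iff)
  then have s: "(\<lambda>n. real (Suc n) powr (-3/2)) summable_on UNIV"
    by (intro norm_summable_imp_summable_on) simp
  have "?f summable_on range int"
    by (subst summable_on_reindex) (use s in \<open>simp_all add: o_def\<close>)
  moreover have "?f summable_on range (\<lambda>n. - int n)"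
    by (subst summable_on_reindex) (use s in \<open>simp_all add: o_def inj_on_def\<close>)
  moreover have "range int \<union> range (\<lambda>n. - int n) = UNIV"
    by (auto intro: int_cases2)
  ultimately show ?thesis using summable_on_union by metis
qed

text \<open>
  Since \<open>(1 + |m|) (1 + |n|) \<le> 4 (max |m| |n|)^2\<close> for \<open>(m, n) \<noteq> (0, 0)\<close>, this product dominates, up to a constant, the cubes of the reciprocals of the
  lattice points, and no counting of lattice points is needed.
\<close>
lemma summable_on_int_prod_powr:
  "(\<lambda>(m::int, n::int). ((1 + \<bar>real_of_int m\<bar>) * (1 + \<bar>real_of_int n\<bar>)) powr (-3/2)) summable_on UNIV"
proof -
  let ?f = "\<lambda>m::int. (1 + \<bar>real_of_int m\<bar>) powr (-3/2)"
  have "(\<lambda>(m::int, n::int). ((1 + \<bar>real_of_int m\<bar>) * (1 + \<bar>real_of_int n\<bar>)) powr (-3/2)) summable_on (UNIV \<times> UNIV)"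
  proof (rule summable_on_SigmaI)
    show "((\<lambda>n. case (m, n) of (m::int, n::int) \<Rightarrow> ((1 + \<bar>real_of_int m\<bar>) * (1 + \<bar>real_of_int n\<bar>)) powr (-3/2))
       has_sum ?f m * infsum ?f UNIV) UNIV" for m
      using has_sum_cmult_right[OF has_sum_infsum[OF summable_on_int_powr], of "?f m"] by (simp add: powr_mult)
    show "(\<lambda>m. ?f m * infsum ?f UNIV) summable_on UNIV"
      by (rule summable_on_cmult_left[OF summable_on_int_powr])
  qed auto
  then show ?thesis by simp
qed

lemma has_field_derivative_shifted_inverse_square:
  fixes z w :: "'a :: real_normed_field"
  assumes "z \<noteq> w"
  shows "((\<lambda>z. 1 / (z - w)\<^sup>2 - c) has_field_derivative -2 * (1 / (z - w) ^ 3)) (at z)"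
proof -
  define d where "d = z - w"
  have "d \<noteq> 0" using assms by (simp add: d_def)
  then have "- (2 * d) / (d\<^sup>2 * d\<^sup>2) = -2 * (1 / d ^ 3)"
    by (simp add: divide_simps) (simp add: power2_eq_square power3_eq_cube power4_eq_xxxx)
  moreover have "((\<lambda>z. 1 / (z - w)\<^sup>2 - c) has_field_derivative - (2 * d) / (d\<^sup>2 * d\<^sup>2)) (at z)"
    using assms by (auto intro!: derivative_eq_intros simp: d_def)
  ultimately show ?thesis by (simp only: d_def)
qed

lemma has_sum_diff:
  fixes f g :: "'a \<Rightarrow> 'b :: topological_ab_group_add"
  assumes "(f has_sum a) A" "(g has_sum b) A"
  shows "((\<lambda>x. f x - g x) has_sum (a - b)) A"
  using has_sum_add[OF assms(1), of "\<lambda>x. - g x" "- b"] assms(2) by (simp add: has_sum_uminus)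

text \<open>\<open>Im (cnj w1 * w2)\<close> is the signed area of the period parallelogram, so the
  assumption is linear independence of the periods over the reals.\<close>

locale complex_lattice =
  fixes w1 w2 :: complex
  assumes indep: "Im (cnj w1 * w2) \<noteq> 0"
begin

section \<open>Lattice geometry: group structure, coordinates, discreteness\<close>

abbreviation L :: "complex set" where "L \<equiv> lattice w1 w2"

lemma lattice_zero: "0 \<in> L"
  unfolding lattice_def by (auto intro!: exI[of _ 0])

lemma lattice_gen1: "w1 \<in> L" and lattice_gen2: "w2 \<in> L"
  unfolding lattice_def by (auto intro: exI[of _ 1] exI[of _ 0])

lemma lattice_add: "v \<in> L \<Longrightarrow> w \<in> L \<Longrightarrow> v + w \<in> L"
proof -
  have "\<exists>m n. (of_int a * w1 + of_int b * w2) + (of_int c * w1 + of_int d * w2) = of_int m * w1 + of_int n * w2" for a b c d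
    by (rule exI[of _ "a + c"], rule exI[of _ "b + d"]) (simp add: algebra_simps)
  then show "v \<in> L \<Longrightarrow> w \<in> L \<Longrightarrow> v + w \<in> L" unfolding lattice_def by blast
qed

lemma lattice_uminus: "v \<in> L \<Longrightarrow> - v \<in> L"
proof -
  have "\<exists>m n. - (of_int a * w1 + of_int b * w2) = of_int m * w1 + of_int n * w2" for a b
    by (rule exI[of _ "- a"], rule exI[of _ "- b"]) simp
  then show "v \<in> L \<Longrightarrow> - v \<in> L" unfolding lattice_def by blast
qed

lemma lattice_uminus_iff: "- v \<in> L \<longleftrightarrow> v \<in> L"
  using lattice_uminus[of v] lattice_uminus[of "- v"] by auto

lemma lattice_add_iff: "v \<in> L \<Longrightarrow> z + v \<in> L \<longleftrightarrow> z \<in> L"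
  using lattice_add[of "z + v" "- v"] lattice_add[of z v] lattice_uminus by auto

text \<open>Cramer's rule: pairing a w1 + b w2 with one period under Im (cnj x * y) isolates the
  coordinate of the other, up to the signed area. Uniqueness of coordinates, discreteness and
  convergence of the lattice sums all rest on this estimate.\<close>

lemma coordinates_le_norm:
  obtains K where "K > 0"
    "\<And>a b :: real. \<bar>a\<bar> \<le> K * norm (of_real a * w1 + of_real b * w2)"
    "\<And>a b :: real. \<bar>b\<bar> \<le> K * norm (of_real a * w1 + of_real b * w2)"
proof
  let ?D = "\<bar>Im (cnj w1 * w2)\<bar>" and ?w = "\<lambda>a b :: real. of_real a * w1 + of_real b * w2"
  have D: "?D > 0" using indep by simp
  have "w1 \<noteq> 0" using indep by auto
  then show "(norm w1 + norm w2) / ?D > 0" using D by (auto intro!: divide_pos_pos add_pos_nonneg)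
  fix a b :: real
  have "Im (cnj (?w a b) * w2) = a * Im (cnj w1 * w2)" by (simp add: algebra_simps)
  then have "\<bar>a\<bar> * ?D \<le> norm (cnj (?w a b) * w2)" by (metis abs_Im_le_cmod abs_mult)
  also have "\<dots> \<le> (norm w1 + norm w2) * norm (?w a b)" by (simp add: norm_mult algebra_simps del: complex_cnj_add)
  finally show "\<bar>a\<bar> \<le> (norm w1 + norm w2) / ?D * norm (?w a b)" using D by (simp add: field_simps)
  have "Im (cnj w1 * ?w a b) = b * Im (cnj w1 * w2)" by (simp add: algebra_simps)
  then have "\<bar>b\<bar> * ?D \<le> norm (cnj w1 * ?w a b)" by (metis abs_Im_le_cmod abs_mult)
  also have "\<dots> \<le> (norm w1 + norm w2) * norm (?w a b)" unfolding norm_mult complex_mod_cnj by (intro mult_right_mono) auto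
  finally show "\<bar>b\<bar> \<le> (norm w1 + norm w2) / ?D * norm (?w a b)" using D by (simp add: field_simps)
qed

lemma inj_coordinates: 
  "of_real a * w1 + of_real b * w2 = of_real c * w1 + of_real d * w2 \<longleftrightarrow> a = c \<and> b = d" for a b c d :: real
proof
  assume e: "of_real a * w1 + of_real b * w2 = of_real c * w1 + of_real d * w2"
  then have "of_real (a - c) * w1 + of_real (b - d) * w2 = 0" by (simp add: algebra_simps)
  moreover obtain K where "K > 0"
    "\<And>a b :: real. \<bar>a\<bar> \<le> K * norm (of_real a * w1 + of_real b * w2)"
    "\<And>a b :: real. \<bar>b\<bar> \<le> K * norm (of_real a * w1 + of_real b * w2)"
    using coordinates_le_norm by blast
  ultimately have "\<bar>a - c\<bar> \<le> 0" "\<bar>b - d\<bar> \<le> 0" by (metis mult_zero_right norm_zero)+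
  then show "a = c \<and> b = d" by simp
qed simp

lemma lattice_eq_image: "L = (\<lambda>(m, n). of_real (real_of_int m) * w1 + of_real (real_of_int n) * w2) ` UNIV"
  by (auto simp: lattice_def)

lemma inj_lattice: "inj (\<lambda>(m, n). of_real (real_of_int m) * w1 + of_real (real_of_int n) * w2)"
  by (rule injI, clarify) (simp only: inj_coordinates of_int_eq_iff)

lemma countable_lattice: "countable L"
  unfolding lattice_eq_image by (rule countable_image) simp

lemma finite_lattice_cball: "finite {w \<in> L. norm w \<le> R}"
proof -
  obtain K where K: "K > 0"
    "\<And>a b :: real. \<bar>a\<bar> \<le> K * norm (of_real a * w1 + of_real b * w2)"
    "\<And>a b :: real. \<bar>b\<bar> \<le> K * norm (of_real a * w1 + of_real b * w2)"
    using coordinates_le_norm by blast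
  define N where "N = \<lceil>K * R\<rceil>"
  have "{w \<in> L. norm w \<le> R} \<subseteq> (\<lambda>(m, n). of_real (real_of_int m) * w1 + of_real (real_of_int n) * w2) ` ({-N..N} \<times> {-N..N})"
  proof
    fix w assume "w \<in> {w \<in> L. norm w \<le> R}"
    then obtain m n where w: "w = of_real (real_of_int m) * w1 + of_real (real_of_int n) * w2" "norm w \<le> R"
      unfolding lattice_eq_image by auto
    have *: "K * norm w \<le> K * R" using w K by simp
    have "\<bar>real_of_int m\<bar> \<le> K * R" using K(2)[where a = m and b = n, folded w(1)] * w by linarith
    moreover have "\<bar>real_of_int n\<bar> \<le> K * R" using K(3)[where a = m and b = n, folded w(1)] * w by linarith
    ultimately have "(m, n) \<in> {-N..N} \<times> {-N..N}" unfolding N_def by auto linarith+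
    then show "w \<in> (\<lambda>(m, n). of_real (real_of_int m) * w1 + of_real (real_of_int n) * w2) ` ({-N..N} \<times> {-N..N})"
      using w by force
  qed
  then show ?thesis by (rule finite_subset) simp
qed

lemma lattice_min_norm:
  obtains d where "d > 0" "\<And>w. w \<in> L \<Longrightarrow> w \<noteq> 0 \<Longrightarrow> d \<le> norm w"
proof -
  obtain K where K: "K > 0"
    "\<And>a b :: real. \<bar>a\<bar> \<le> K * norm (of_real a * w1 + of_real b * w2)"
    "\<And>a b :: real. \<bar>b\<bar> \<le> K * norm (of_real a * w1 + of_real b * w2)"
    using coordinates_le_norm by blast
  have "1 / K \<le> norm w" if wL: "w \<in> L" "w \<noteq> 0" for w
  proof -
    obtain m n where w: "w = of_real (real_of_int m) * w1 + of_real (real_of_int n) * w2"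
      using wL unfolding lattice_eq_image by auto
    then have "m \<noteq> 0 \<or> n \<noteq> 0" using wL by auto
    then have "1 \<le> \<bar>real_of_int m\<bar> \<or> 1 \<le> \<bar>real_of_int n\<bar>" by linarith
    then have "1 \<le> K * norm w" using K(2)[where a = m and b = n, folded w] K(3)[where a = m and b = n, folded w] by linarith
    then show ?thesis using K by (simp add: field_simps)
  qed
  then show ?thesis using that[of "1 / K"] K by simp
qed

lemma summable_on_lattice_cube: "(\<lambda>w. 1 / norm w ^ 3) summable_on (L - {0})"
proof -
  obtain K where K: "K > 0"
    "\<And>a b :: real. \<bar>a\<bar> \<le> K * norm (of_real a * w1 + of_real b * w2)"
    "\<And>a b :: real. \<bar>b\<bar> \<le> K * norm (of_real a * w1 + of_real b * w2)"
    using coordinates_le_norm by blast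
  let ?h = "\<lambda>(m, n). of_real (real_of_int m) * w1 + of_real (real_of_int n) * w2"
  let ?g = "\<lambda>(m::int, n::int). ((1 + \<bar>real_of_int m\<bar>) * (1 + \<bar>real_of_int n\<bar>)) powr (-3/2)"
  have "L - {0} = ?h ` (UNIV - {(0,0)})"
    unfolding lattice_eq_image using image_set_diff[OF inj_lattice, of UNIV "{(0,0)}"] by simp
  moreover have "(\<lambda>w. 1 / norm w ^ 3) summable_on (?h ` (UNIV - {(0,0)}))"
  proof (subst summable_on_reindex)
    show "inj_on ?h (UNIV - {(0,0)})" using inj_lattice by (rule inj_on_subset) simp
    show "(\<lambda>w. 1 / norm w ^ 3) \<circ> ?h summable_on (UNIV - {(0,0)})"
    proof (rule summable_on_comparison_test)
      show "(\<lambda>p. (2 * K) ^ 3 * ?g p) summable_on (UNIV - {(0,0)})"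
        by (rule summable_on_subset, rule summable_on_cmult_right[OF summable_on_int_prod_powr]) simp
      fix p :: "int \<times> int" assume p: "p \<in> UNIV - {(0,0)}"
      obtain m n where mn: "p = (m, n)" by force
      define w where "w = of_real (real_of_int m) * w1 + of_real (real_of_int n) * w2"
      have "1 \<le> \<bar>real_of_int m\<bar> \<or> 1 \<le> \<bar>real_of_int n\<bar>" using p mn by auto
      \<comment> \<open>Away from the origin some coordinate has absolute value at least 1, so
        \<open>K * norm w\<close> is at least 1. This absorbs the 1 in each factor 1 + |m| and is
        the source of the constant \<open>2 * K\<close>.\<close>
      then have le: "1 \<le> K * norm w" "\<bar>real_of_int m\<bar> \<le> K * norm w" "\<bar>real_of_int n\<bar> \<le> K * norm w"
        using K(2)[where a = m and b = n, folded w_def] K(3)[where a = m and b = n, folded w_def] by linarith+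
      have nw: "norm w > 0" using le(1) by (metis mult_zero_right norm_le_zero_iff not_le norm_zero zero_less_one)
      define P where "P = (1 + \<bar>real_of_int m\<bar>) * (1 + \<bar>real_of_int n\<bar>)"
      have P0: "P > 0" unfolding P_def by (intro mult_pos_pos) auto
      have "P \<le> (2 * K * norm w) * (2 * K * norm w)" unfolding P_def using le by (intro mult_mono) auto
      also have "\<dots> = (2 * K * norm w) powr 2" using K nw by (simp add: powr_numeral power2_eq_square)
      finally have "P powr (3/2) \<le> ((2 * K * norm w) powr 2) powr (3/2)" using P0 by (intro powr_mono2) auto
      also have "\<dots> = (2 * K * norm w) ^ 3" unfolding powr_powr using K nw by (simp add: powr_numeral)
      finally have *: "P powr (3/2) \<le> (2 * K * norm w) ^ 3" .
      have "1 / norm w ^ 3 = (2 * K) ^ 3 / (2 * K * norm w) ^ 3" using K nw by (simp add: power_mult_distrib)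
      also have "\<dots> \<le> (2 * K) ^ 3 / P powr (3/2)" using * K P0 by (intro divide_left_mono) (auto intro!: mult_pos_pos simp: nw)
      also have "\<dots> = (2 * K) ^ 3 * P powr (-3/2)" by (simp add: powr_minus_divide)
      finally show "((\<lambda>w. 1 / norm w ^ 3) \<circ> ?h) p \<le> (2 * K) ^ 3 * ?g p"
        by (simp add: mn w_def P_def)
    qed (auto split: prod.splits)
  qed
  ultimately show ?thesis by simp
qed

lemma summable_on_lattice_power:
  assumes "k \<ge> 3"
  shows "(\<lambda>w. 1 / norm w ^ k) summable_on (L - {0})" "(\<lambda>w. 1 / w ^ k) summable_on (L - {0})"
proof -
  obtain d where d: "d > 0" "\<And>w. w \<in> L \<Longrightarrow> w \<noteq> 0 \<Longrightarrow> d \<le> norm w" using lattice_min_norm by blast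
  show "(\<lambda>w. 1 / norm w ^ k) summable_on (L - {0})"
  proof (rule summable_on_comparison_test)
    show "(\<lambda>w. (1 / d ^ (k - 3)) * (1 / norm w ^ 3)) summable_on (L - {0})"
      by (rule summable_on_cmult_right[OF summable_on_lattice_cube])
    fix w assume w: "w \<in> L - {0}"
    have "norm w ^ k = norm w ^ (k - 3) * norm w ^ 3" using assms by (simp flip: power_add)
    moreover have "d ^ (k - 3) \<le> norm w ^ (k - 3)" using d w by (intro power_mono) auto
    ultimately show "1 / norm w ^ k \<le> (1 / d ^ (k - 3)) * (1 / norm w ^ 3)"
      using d(1) w by (simp add: divide_simps mult_right_mono)
  qed auto
  then have "(\<lambda>w. norm (1 / w ^ k)) summable_on (L - {0})" by (simp add: norm_divide norm_power)
  then show "(\<lambda>w. 1 / w ^ k) summable_on (L - {0})" by (rule abs_summable_summable)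
qed

text \<open>Keeping the poles at twice the radius makes |z - w| at least |w| / 2 on the closed disc.
  The terms are then dominated by multiples of 1 / |w|^3, so the finite partial sums converge
  uniformly and complex differentiation passes to the limit.\<close>

lemma lattice_tail_derivative:
  assumes R: "R > 0" and A: "A \<subseteq> {w \<in> L. 2 * R \<le> norm w}" and z: "norm z < R"
  shows "(\<lambda>w. 1 / (z - w)\<^sup>2 - 1 / w\<^sup>2) summable_on A"
    and "(\<lambda>w. 1 / (z - w) ^ 3) summable_on A"
    and "((\<lambda>z. \<Sum>\<^sub>\<infinity>w\<in>A. 1 / (z - w)\<^sup>2 - 1 / w\<^sup>2) has_field_derivative -2 * (\<Sum>\<^sub>\<infinity>w\<in>A. 1 / (z - w) ^ 3)) (at z)"
proof -
  have A': "A \<subseteq> L - {0}" using A R by auto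
  have sum3: "(\<lambda>w. c * (1 / norm w ^ 3)) summable_on A" for c
    by (rule summable_on_subset[OF summable_on_cmult_right[OF summable_on_lattice_cube] A'])
  have dist: "norm w / 2 \<le> norm (z - w)" if "w \<in> A" "norm z \<le> R" for w z
  proof -
    have "norm w \<le> norm (z - w) + norm z" by (metis norm_minus_commute norm_triangle_sub add.commute)
    then show ?thesis using that A by auto
  qed
  have pos: "norm w > 0" if "w \<in> A" for w using that A' by auto
  \<comment> \<open>Subtracting 1 / w^2 cancels the leading term and gains one power of |w|. In 10 R
    = R * (5/2) * 4 the factor 5/2 bounds |2 w - z| / |w|, and 4 comes from (|w| / 2)^2.\<close>
  have bd2: "norm (1 / (z - w)\<^sup>2 - 1 / w\<^sup>2) \<le> 10 * R * (1 / norm w ^ 3)" if w: "w \<in> A" and z: "norm z \<le> R" for w z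
  proof -
    have nz: "w \<noteq> 0" "z - w \<noteq> 0" using dist[OF w z] pos[OF w] by auto
    have "1 / (z - w)\<^sup>2 - 1 / w\<^sup>2 = z * (2 * w - z) / (w\<^sup>2 * (z - w)\<^sup>2)"
      using nz by (simp add: divide_simps) (simp add: power2_eq_square algebra_simps)
    then have "norm (1 / (z - w)\<^sup>2 - 1 / w\<^sup>2) = norm z * norm (2 * w - z) / ((norm w)\<^sup>2 * (norm (z - w))\<^sup>2)"
      by (simp add: norm_divide norm_mult norm_power)
    also have "\<dots> \<le> R * (5/2 * norm w) / ((norm w)\<^sup>2 * (norm w / 2)\<^sup>2)"
    proof (intro frac_le mult_mono power_mono)
      have "norm (2 * w - z) \<le> 2 * norm w + norm z" by (metis norm_mult norm_numeral norm_triangle_ineq4)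
      then show "norm (2 * w - z) \<le> 5/2 * norm w" using w z A by auto
    qed (use R z dist[OF w z] pos[OF w] nz in auto)
    also have "\<dots> = 10 * R * (1 / norm w ^ 3)" using pos[OF w] by (simp add: field_simps power2_eq_square power3_eq_cube)
    finally show ?thesis .
  qed
  have bd3: "norm (1 / (z - w) ^ 3) \<le> 8 * (1 / norm w ^ 3)" if w: "w \<in> A" and z: "norm z \<le> R" for w z
  proof -
    have "norm (1 / (z - w) ^ 3) = 1 / norm (z - w) ^ 3" by (simp add: norm_divide norm_power)
    also have "\<dots> \<le> 1 / (norm w / 2) ^ 3" using dist[OF w z] pos[OF w] by (intro divide_left_mono power_mono) (auto intro!: mult_pos_pos)
    finally show ?thesis by (simp add: power_divide)
  qed
  show s2: "(\<lambda>w. 1 / (z - w)\<^sup>2 - 1 / w\<^sup>2) summable_on A"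
    by (rule abs_summable_summable, rule Infinite_Sum.abs_summable_on_comparison_test'[OF sum3 bd2]) (use z in auto)
  show s3: "(\<lambda>w. 1 / (z - w) ^ 3) summable_on A"
    by (rule abs_summable_summable, rule Infinite_Sum.abs_summable_on_comparison_test'[OF sum3 bd3]) (use z in auto)
  let ?F = "finite_subsets_at_top A"
  have ul: "uniform_limit (cball 0 R) (\<lambda>X z. \<Sum>w\<in>X. 1 / (z - w)\<^sup>2 - 1 / w\<^sup>2) (\<lambda>z. \<Sum>\<^sub>\<infinity>w\<in>A. 1 / (z - w)\<^sup>2 - 1 / w\<^sup>2) ?F"
    by (rule Weierstrass_m_test_general[OF bd2 sum3]) auto
  have d: "((\<lambda>z. \<Sum>w\<in>X. 1 / (z - w)\<^sup>2 - 1 / w\<^sup>2) has_field_derivative (\<Sum>w\<in>X. -2 * (1 / (z - w) ^ 3))) (at z)"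
    if "X \<subseteq> A" "norm z \<le> R" for X z
  proof (rule DERIV_sum)
    fix w assume "w \<in> X"
    then have "z - w \<noteq> 0" using dist[of w z] pos[of w] that by auto
    then show "((\<lambda>z. 1 / (z - w)\<^sup>2 - 1 / w\<^sup>2) has_field_derivative -2 * (1 / (z - w) ^ 3)) (at z)"
      by (intro has_field_derivative_shifted_inverse_square) simp
  qed
  \<comment> \<open>The derivative is obtained only as the limit of the derivatives of the partial
    sums; uniqueness of limits identifies it with the cubic series below.\<close>
  obtain g' where g': "\<And>z. z \<in> ball 0 R \<Longrightarrow> ((\<lambda>z. \<Sum>\<^sub>\<infinity>w\<in>A. 1 / (z - w)\<^sup>2 - 1 / w\<^sup>2) has_field_derivative g' z) (at z)
      \<and> ((\<lambda>X. \<Sum>w\<in>X. -2 * (1 / (z - w) ^ 3)) \<longlongrightarrow> g' z) ?F"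
  proof (rule has_complex_derivative_uniform_limit[OF _ ul _ R])
    show "\<forall>\<^sub>F X in ?F. continuous_on (cball 0 R) (\<lambda>z. \<Sum>w\<in>X. 1 / (z - w)\<^sup>2 - 1 / w\<^sup>2) \<and>
        (\<forall>z\<in>ball 0 R. ((\<lambda>z. \<Sum>w\<in>X. 1 / (z - w)\<^sup>2 - 1 / w\<^sup>2) has_field_derivative (\<Sum>w\<in>X. -2 * (1 / (z - w) ^ 3))) (at z))"
    proof (rule eventually_finite_subsets_at_top_weakI, intro conjI ballI)
      fix X assume X: "finite X" "X \<subseteq> A"
      show "continuous_on (cball 0 R) (\<lambda>z. \<Sum>w\<in>X. 1 / (z - w)\<^sup>2 - 1 / w\<^sup>2)"
        by (rule DERIV_continuous_on, rule has_field_derivative_at_within, rule d[OF X(2)]) simp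
      fix z :: complex assume "z \<in> ball 0 R"
      then show "((\<lambda>z. \<Sum>w\<in>X. 1 / (z - w)\<^sup>2 - 1 / w\<^sup>2) has_field_derivative (\<Sum>w\<in>X. -2 * (1 / (z - w) ^ 3))) (at z)"
        by (intro d X) auto
    qed
  qed (auto simp: finite_subsets_at_top_neq_bot)
  have "((\<lambda>w. -2 * (1 / (z - w) ^ 3)) has_sum (-2 * (\<Sum>\<^sub>\<infinity>w\<in>A. 1 / (z - w) ^ 3))) A"
    by (intro has_sum_cmult_right has_sum_infsum s3)
  then have "((\<lambda>X. \<Sum>w\<in>X. -2 * (1 / (z - w) ^ 3)) \<longlongrightarrow> (-2 * (\<Sum>\<^sub>\<infinity>w\<in>A. 1 / (z - w) ^ 3))) ?F"
    by (simp only: has_sum_def)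
  then have "g' z = -2 * (\<Sum>\<^sub>\<infinity>w\<in>A. 1 / (z - w) ^ 3)"
    using g'[of z] z tendsto_unique[OF finite_subsets_at_top_neq_bot] by auto
  then show "((\<lambda>z. \<Sum>\<^sub>\<infinity>w\<in>A. 1 / (z - w)\<^sup>2 - 1 / w\<^sup>2) has_field_derivative -2 * (\<Sum>\<^sub>\<infinity>w\<in>A. 1 / (z - w) ^ 3)) (at z)"
    using g'[of z] z by auto
qed

text \<open>Without the pole at 0 the function is holomorphic there, so that it can be expanded at
  the origin.\<close>

definition wp_reg :: "complex \<Rightarrow> complex" where
  "wp_reg z = (\<Sum>\<^sub>\<infinity>w\<in>L - {0}. 1 / (z - w)\<^sup>2 - 1 / w\<^sup>2)"

text \<open>The sum runs over the whole lattice, the point 0 contributing the derivative -2 / z^3 of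
  the principal part. In this form a translation by a period is a mere reindexing.\<close>

definition wp' :: "complex \<Rightarrow> complex" where
  "wp' z = -2 * (\<Sum>\<^sub>\<infinity>w\<in>L. 1 / (z - w) ^ 3)"

lemma wp_eq: "wp w1 w2 z = 1 / z\<^sup>2 + wp_reg z"
  by (simp add: wp_def wp_reg_def)

lemma wp_reg_derivative:
  assumes z: "z \<notin> L - {0}"
  shows "(\<lambda>w. 1 / (z - w)\<^sup>2 - 1 / w\<^sup>2) summable_on L - {0}"
    and "(\<lambda>w. 1 / (z - w) ^ 3) summable_on L - {0}"
    and "(wp_reg has_field_derivative -2 * (\<Sum>\<^sub>\<infinity>w\<in>L - {0}. 1 / (z - w) ^ 3)) (at z)"
proof -
  \<comment> \<open>Any radius beyond |z| serves: the finitely many lattice points of norm below 2 R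
    are treated one at a time, the others by the tail estimate.\<close>
  define R where "R = norm z + 1"
  have R: "R > 0" "norm z < R" by (auto simp: R_def add_nonneg_pos)
  define A where "A = {w \<in> L. 2 * R \<le> norm w}"
  define B where "B = {w \<in> L - {0}. norm w < 2 * R}"
  have AB: "L - {0} = B \<union> A" "B \<inter> A = {}" using R by (auto simp: A_def B_def)
  have finB: "finite B" by (rule finite_subset[OF _ finite_lattice_cball[of "2 * R"]]) (auto simp: B_def)
  note tail = lattice_tail_derivative[OF R(1), of A]
  show "(\<lambda>w. 1 / (z - w)\<^sup>2 - 1 / w\<^sup>2) summable_on L - {0}" "(\<lambda>w. 1 / (z - w) ^ 3) summable_on L - {0}"
    unfolding AB(1) using finB tail(1,2)[of z] R by (intro summable_on_union; simp add: A_def)+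
  have eq: "(\<Sum>w\<in>B. 1 / (z - w)\<^sup>2 - 1 / w\<^sup>2) + (\<Sum>\<^sub>\<infinity>w\<in>A. 1 / (z - w)\<^sup>2 - 1 / w\<^sup>2) = wp_reg z" if "z \<in> ball 0 R" for z
    unfolding wp_reg_def AB(1) using finB tail(1)[of z] that AB(2)
    by (subst infsum_Un_disjoint) (auto simp: A_def)
  have eq3: "(\<Sum>w\<in>B. 1 / (z - w) ^ 3) + (\<Sum>\<^sub>\<infinity>w\<in>A. 1 / (z - w) ^ 3) = (\<Sum>\<^sub>\<infinity>w\<in>L - {0}. 1 / (z - w) ^ 3)"
    unfolding AB(1) using finB tail(2)[of z] R AB(2)
    by (subst infsum_Un_disjoint) (auto simp: A_def)
  have "((\<lambda>z. \<Sum>w\<in>B. 1 / (z - w)\<^sup>2 - 1 / w\<^sup>2) has_field_derivative (\<Sum>w\<in>B. -2 * (1 / (z - w) ^ 3))) (at z)"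
  proof (rule DERIV_sum)
    fix w assume "w \<in> B"
    then have "z - w \<noteq> 0" using z by (auto simp: B_def)
    then show "((\<lambda>z. 1 / (z - w)\<^sup>2 - 1 / w\<^sup>2) has_field_derivative -2 * (1 / (z - w) ^ 3)) (at z)"
      by (intro has_field_derivative_shifted_inverse_square) simp
  qed
  then have "((\<lambda>z. (\<Sum>w\<in>B. 1 / (z - w)\<^sup>2 - 1 / w\<^sup>2) + (\<Sum>\<^sub>\<infinity>w\<in>A. 1 / (z - w)\<^sup>2 - 1 / w\<^sup>2))
     has_field_derivative -2 * (\<Sum>\<^sub>\<infinity>w\<in>L - {0}. 1 / (z - w) ^ 3)) (at z)"
    unfolding eq3[symmetric] distrib_left sum_distrib_left
    by (rule DERIV_add) (use tail(3)[of z] R in \<open>simp add: A_def\<close>)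
  then show "(wp_reg has_field_derivative -2 * (\<Sum>\<^sub>\<infinity>w\<in>L - {0}. 1 / (z - w) ^ 3)) (at z)"
    by (rule has_field_derivative_transform_within_open[where S = "ball 0 R"]) (use R eq in auto)
qed

section \<open>The differential equation of the Weierstrass function\<close>

lemma closed_lattice: "closed L"
proof -
  obtain d where d: "d > 0" "\<And>w. w \<in> L \<Longrightarrow> w \<noteq> 0 \<Longrightarrow> d \<le> norm w" using lattice_min_norm by blast
  show ?thesis
  proof (rule discrete_imp_closed[OF d(1)], intro ballI impI)
    fix x y assume "x \<in> L" "y \<in> L" "dist y x < d"
    then show "y = x" using d(2)[of "y + - x"] lattice_add[of y "- x"] lattice_uminus[of x]
      by (auto simp: dist_norm)
  qed
qed

text \<open>By uniqueness of coordinates, since 1/2 is not an integer. At half periods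
  \<open>wp\<close> can therefore be compared with its translate without meeting a pole.\<close>

lemma half_lattice: "w1 / 2 \<notin> L" "w2 / 2 \<notin> L"
proof -
  have 1: "complex_of_real (1/2) * w1 + complex_of_real 0 * w2 = w1 / 2" by simp
  have 2: "complex_of_real 0 * w1 + complex_of_real (1/2) * w2 = w2 / 2" by simp
  have *: "1/2 \<noteq> real_of_int m" for m
  proof
    assume "1/2 = real_of_int m"
    then have "real_of_int (2 * m) = real_of_int 1" by simp
    then have "2 * m = 1" by (simp only: of_int_eq_iff)
    then show False by presburger
  qed
  show "w1 / 2 \<notin> L" "w2 / 2 \<notin> L"
    unfolding lattice_eq_image 1[symmetric] 2[symmetric]
    by (auto simp only: image_iff split: prod.splits) (use * inj_coordinates in metis)+
qed

lemma wp'_eq: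
  assumes "z \<notin> L - {0}"
  shows "wp' z = - 2 / z ^ 3 - 2 * (\<Sum>\<^sub>\<infinity>w\<in>L - {0}. 1 / (z - w) ^ 3)"
proof -
  have "(\<Sum>\<^sub>\<infinity>w\<in>insert 0 (L - {0}). 1 / (z - w) ^ 3) = 1 / (z - 0) ^ 3 + (\<Sum>\<^sub>\<infinity>w\<in>L - {0}. 1 / (z - w) ^ 3)"
    by (rule infsum_insert) (use wp_reg_derivative(2)[OF assms] in auto)
  then show ?thesis using lattice_zero by (simp add: wp'_def insert_absorb algebra_simps)
qed

lemma wp_has_field_derivative:
  assumes "z \<notin> L"
  shows "(wp w1 w2 has_field_derivative wp' z) (at z)"
proof -
  have z: "z \<notin> L - {0}" "z \<noteq> 0" using assms lattice_zero by auto
  have "((\<lambda>z. (1 / (z - 0)\<^sup>2 - 0) + wp_reg z) has_field_derivative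
     -2 * (1 / (z - 0) ^ 3) + -2 * (\<Sum>\<^sub>\<infinity>w\<in>L - {0}. 1 / (z - w) ^ 3)) (at z)"
    by (intro DERIV_add has_field_derivative_shifted_inverse_square wp_reg_derivative(3) z)
  then show ?thesis using z by (simp add: wp'_eq wp_eq[abs_def])
qed

lemma holomorphic_wp: "wp w1 w2 holomorphic_on - L"
  using wp_has_field_derivative closed_lattice by (auto simp: holomorphic_on_open open_Compl)

lemma holomorphic_wp': "wp' holomorphic_on - L"
proof -
  have "deriv (wp w1 w2) holomorphic_on - L"
    by (intro holomorphic_deriv holomorphic_wp open_Compl closed_lattice)
  then show ?thesis
    by (rule holomorphic_transform) (auto intro: DERIV_imp_deriv wp_has_field_derivative)
qed

section \<open>Parity and periodicity\<close>

lemma bij_betw_lattice_uminus: "bij_betw uminus L L" "bij_betw uminus (L - {0}) (L - {0})"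
  by (rule bij_betw_byWitness[where f' = uminus], auto simp: lattice_uminus_iff)+

lemma wp'_add_lattice: "v \<in> L \<Longrightarrow> wp' (z + v) = wp' z"
proof -
  assume v: "v \<in> L"
  have "bij_betw (\<lambda>w. w + v) L L"
    by (rule bij_betw_byWitness[where f' = "\<lambda>w. w + - v"])
      (auto simp: lattice_add v lattice_add[OF _ lattice_uminus[OF v], simplified])
  from infsum_reindex_bij_betw[OF this, of "\<lambda>w. 1 / (z + v - w) ^ 3"]
  show ?thesis by (simp add: wp'_def)
qed

lemma wp_uminus: "wp w1 w2 (- z) = wp w1 w2 z"
proof -
  have "wp_reg (- z) = (\<Sum>\<^sub>\<infinity>w\<in>L - {0}. 1 / (- z - - w)\<^sup>2 - 1 / (- w)\<^sup>2)"
    unfolding wp_reg_def by (rule infsum_reindex_bij_betw[OF bij_betw_lattice_uminus(2), symmetric])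
  also have "\<dots> = wp_reg z"
    unfolding wp_reg_def by (rule infsum_cong) (simp add: power2_commute)
  finally show ?thesis by (simp add: wp_eq)
qed

lemma infsum_lattice_odd_power:
  assumes "odd k"
  shows "(\<Sum>\<^sub>\<infinity>w\<in>L - {0}. 1 / w ^ k) = 0"
proof -
  have "(\<Sum>\<^sub>\<infinity>w\<in>L - {0}. 1 / w ^ k) = (\<Sum>\<^sub>\<infinity>w\<in>L - {0}. 1 / (- w) ^ k)"
    by (rule infsum_reindex_bij_betw[OF bij_betw_lattice_uminus(2), symmetric])
  also have "\<dots> = - (\<Sum>\<^sub>\<infinity>w\<in>L - {0}. 1 / w ^ k)"
    using assms by (simp add: infsum_uminus power_minus_odd)
  finally show ?thesis by simp
qed

text \<open>The correction terms 1 / w^2 block a reindexing of the series of \<open>wp\<close>, but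
  its derivative is periodic. Hence the difference of \<open>wp\<close> and its translate is
  constant off the lattice, whose complement is connected because the lattice is countable.\<close>

lemma wp_add_period:
  assumes v: "v \<in> L" "v / 2 \<notin> L" and z: "z \<notin> L"
  shows "wp w1 w2 (z + v) = wp w1 w2 z"
proof -
  define g where "g = (\<lambda>z. wp w1 w2 (z + v) - wp w1 w2 z)"
  have d: "(g has_field_derivative 0) (at z)" if "z \<in> - L" for z
  proof -
    have "(g has_field_derivative wp' (z + v) - wp' z) (at z)"
      unfolding g_def using that v(1)
      by (intro DERIV_diff DERIV_shift[THEN iffD1] wp_has_field_derivative) (auto simp: lattice_add_iff)
    then show ?thesis by (simp add: wp'_add_lattice[OF v(1)])
  qed
  have "connected (UNIV - L)"
    by (rule connected_open_diff_countable) (auto simp: countable_lattice)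
  then have con: "connected (- L)" by (simp add: Compl_eq_Diff_UNIV)
  obtain c where c: "\<And>x. x \<in> - L \<Longrightarrow> g x = c"
  proof (rule DERIV_zero_connected_constant[OF con, of "{}" g])
    show "continuous_on (- L) g"
      by (rule DERIV_continuous_on, rule has_field_derivative_at_within, rule d)
  qed (use d closed_lattice in \<open>auto simp: open_Compl\<close>)
  \<comment> \<open>The constant vanishes because \<open>wp\<close> is even and \<open>- v/2 + v = v/2\<close>.\<close>
  have "- (v / 2) \<notin> L" using v lattice_uminus_iff by metis
  then have "c = g (- (v / 2))" by (simp add: c)
  also have "\<dots> = 0" using wp_uminus[of "v / 2"] by (simp add: g_def)
  finally show ?thesis using c[of z] z by (simp add: g_def)
qed

text \<open>Laurent expansion at 0, just far enough for the differential equation. Each term is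
  expanded by 1 / (z - w)^2 = sum of (n + 1) z^n / w^(n + 2); odd lattice sums vanish, and the even
  ones give 3 E 4 = g2 / 20 and 5 E 6 = g3 / 28.\<close>

lemma wp_expansion:
  defines "a \<equiv> inv_g2 w1 w2 / 20" and "b \<equiv> inv_g3 w1 w2 / 28"
  obtains C d where "d > 0" "\<And>z. norm z < d \<Longrightarrow> z \<notin> L - {0}"
    "\<And>z. norm z < d \<Longrightarrow> norm (wp_reg z - (a * z\<^sup>2 + b * z ^ 4)) \<le> C * norm z ^ 5"
    "\<And>z. norm z < d \<Longrightarrow> norm (wp' z - (- 2 / z ^ 3 + 2 * a * z + 4 * b * z ^ 3)) \<le> C * norm z ^ 4"
proof -
  obtain d where d: "d > 0" "\<And>w. w \<in> L \<Longrightarrow> w \<noteq> 0 \<Longrightarrow> d \<le> norm w" using lattice_min_norm by blast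
  define E where "E = (\<lambda>k. \<Sum>\<^sub>\<infinity>w\<in>L - {0}. 1 / w ^ k)"
  have E: "((\<lambda>w. 1 / w ^ k) has_sum E k) (L - {0})" if "k \<ge> 3" for k
    unfolding E_def by (rule has_sum_infsum[OF summable_on_lattice_power(2)[OF that]])
  have E0: "E 3 = 0" "E 5 = 0" by (simp_all add: E_def infsum_lattice_odd_power)
  have ab: "a = 3 * E 4" "b = 5 * E 6" by (simp_all add: a_def b_def E_def inv_g2_def inv_g3_def)
  define M where "M = (\<Sum>\<^sub>\<infinity>w\<in>L - {0}. 1 / norm w ^ 7)"
  have M: "((\<lambda>w. 1 / norm w ^ 7) has_sum M) (L - {0})"
    unfolding M_def by (rule has_sum_infsum[OF summable_on_lattice_power(1)]) simp
  have dist: "norm w / 2 \<le> norm (z - w)" "norm z \<le> norm w" "w \<noteq> 0" "z - w \<noteq> 0" if "w \<in> L - {0}" "norm z < d / 2" for w z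
  proof -
    have "norm w \<le> norm (z - w) + norm z" by (metis norm_minus_commute norm_triangle_sub add.commute)
    then show "norm w / 2 \<le> norm (z - w)" "norm z \<le> norm w" "w \<noteq> 0" "z - w \<noteq> 0" using that d(1) d(2)[of w] by auto
  qed
  have notin: "z \<notin> L - {0}" if "norm z < d / 2" for z using that d(1) d(2)[of z] by auto
  show ?thesis
  \<comment> \<open>Within half the minimal norm, |z - w| is at least |w| / 2. The two remainders
    have constants 44 = 11 * 2^2 and 784 = 2 * 49 * 2^3; 800 is a common round bound.\<close>
  proof (rule that[of "d / 2" "800 * M"])
    show "d / 2 > 0" using d by simp
    fix z :: complex assume z: "norm z < d / 2"
    show "z \<notin> L - {0}" using notin z .
    have "((\<lambda>w. 1 / (z - w)\<^sup>2 - 1 / w\<^sup>2 - (2 * z * (1 / w ^ 3) + 3 * z\<^sup>2 * (1 / w ^ 4) + 4 * z ^ 3 * (1 / w ^ 5) + 5 * z ^ 4 * (1 / w ^ 6)))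
       has_sum (wp_reg z - (2 * z * E 3 + 3 * z\<^sup>2 * E 4 + 4 * z ^ 3 * E 5 + 5 * z ^ 4 * E 6))) (L - {0})"
      unfolding wp_reg_def
      by (intro has_sum_diff has_sum_add has_sum_cmult_right E has_sum_infsum wp_reg_derivative(1) notin z) auto
    moreover have "((\<lambda>w. 800 * norm z ^ 5 * (1 / norm w ^ 7)) has_sum 800 * norm z ^ 5 * M) (L - {0})"
      by (intro has_sum_cmult_right M)
    moreover have "norm (1 / (z - w)\<^sup>2 - 1 / w\<^sup>2 - (2 * z * (1 / w ^ 3) + 3 * z\<^sup>2 * (1 / w ^ 4) + 4 * z ^ 3 * (1 / w ^ 5) + 5 * z ^ 4 * (1 / w ^ 6)))
        \<le> 800 * norm z ^ 5 * (1 / norm w ^ 7)" if w: "w \<in> L - {0}" for w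
    proof -
      note nz = dist[OF w z]
      \<comment> \<open>The remainder is available in closed form, so no infinite series in z has to
        be estimated.\<close>
      have "1 / (z - w)\<^sup>2 - 1 / w\<^sup>2 - (2 * z * (1 / w ^ 3) + 3 * z\<^sup>2 * (1 / w ^ 4) + 4 * z ^ 3 * (1 / w ^ 5) + 5 * z ^ 4 * (1 / w ^ 6))
        = z ^ 5 * (6 * w - 5 * z) / (w ^ 6 * (z - w)\<^sup>2)"
        using nz(3,4) by (simp add: divide_simps) algebra
      then have "norm (1 / (z - w)\<^sup>2 - 1 / w\<^sup>2 - (2 * z * (1 / w ^ 3) + 3 * z\<^sup>2 * (1 / w ^ 4) + 4 * z ^ 3 * (1 / w ^ 5) + 5 * z ^ 4 * (1 / w ^ 6)))
         = norm z ^ 5 * norm (6 * w - 5 * z) / (norm w ^ 6 * norm (z - w) ^ 2)"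
        by (simp add: norm_divide norm_mult norm_power)
      also have "\<dots> \<le> norm z ^ 5 * (11 * norm w) / (norm w ^ 6 * (norm w / 2) ^ 2)"
      proof (intro frac_le mult_mono power_mono)
        have "norm (6 * w - 5 * z) \<le> 6 * norm w + 5 * norm z" by (rule order.trans[OF norm_triangle_ineq4]) (simp add: norm_mult)
        then show "norm (6 * w - 5 * z) \<le> 11 * norm w" using nz(2) by simp
      qed (use nz in auto)
      also have "\<dots> = 44 * (norm z ^ 5 * (1 / norm w ^ 7))" using nz(3) by (simp add: field_simps eval_nat_numeral)
      also have "\<dots> \<le> 800 * (norm z ^ 5 * (1 / norm w ^ 7))" by (intro mult_right_mono) auto
      finally show ?thesis by (simp only: mult.assoc)
    qed
    ultimately have "norm (wp_reg z - (2 * z * E 3 + 3 * z\<^sup>2 * E 4 + 4 * z ^ 3 * E 5 + 5 * z ^ 4 * E 6)) \<le> 800 * norm z ^ 5 * M"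
      by (rule norm_infsum_le)
    then show "norm (wp_reg z - (a * z\<^sup>2 + b * z ^ 4)) \<le> 800 * M * norm z ^ 5"
      by (simp add: E0 ab mult_ac)
    have "((\<lambda>w. - 2 * (1 / (z - w) ^ 3) - (2 * (1 / w ^ 3) + 6 * z * (1 / w ^ 4) + 12 * z\<^sup>2 * (1 / w ^ 5) + 20 * z ^ 3 * (1 / w ^ 6)))
       has_sum (- 2 * (\<Sum>\<^sub>\<infinity>w\<in>L - {0}. 1 / (z - w) ^ 3) - (2 * E 3 + 6 * z * E 4 + 12 * z\<^sup>2 * E 5 + 20 * z ^ 3 * E 6))) (L - {0})"
      by (intro has_sum_diff has_sum_add has_sum_cmult_right E has_sum_infsum wp_reg_derivative(2) notin z) auto
    moreover have "((\<lambda>w. 800 * norm z ^ 4 * (1 / norm w ^ 7)) has_sum 800 * norm z ^ 4 * M) (L - {0})"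
      by (intro has_sum_cmult_right M)
    moreover have "norm (- 2 * (1 / (z - w) ^ 3) - (2 * (1 / w ^ 3) + 6 * z * (1 / w ^ 4) + 12 * z\<^sup>2 * (1 / w ^ 5) + 20 * z ^ 3 * (1 / w ^ 6)))
        \<le> 800 * norm z ^ 4 * (1 / norm w ^ 7)" if w: "w \<in> L - {0}" for w
    proof -
      note nz = dist[OF w z]
      have "- 2 * (1 / (z - w) ^ 3) - (2 * (1 / w ^ 3) + 6 * z * (1 / w ^ 4) + 12 * z\<^sup>2 * (1 / w ^ 5) + 20 * z ^ 3 * (1 / w ^ 6))
        = - 2 * (z ^ 4 * (15 * w ^ 2 - 24 * z * w + 10 * z ^ 2)) / (w ^ 6 * (z - w) ^ 3)"
        using nz(3,4) by (simp add: divide_simps) algebra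
      then have "norm (- 2 * (1 / (z - w) ^ 3) - (2 * (1 / w ^ 3) + 6 * z * (1 / w ^ 4) + 12 * z\<^sup>2 * (1 / w ^ 5) + 20 * z ^ 3 * (1 / w ^ 6)))
         = 2 * (norm z ^ 4 * norm (15 * w ^ 2 - 24 * z * w + 10 * z ^ 2)) / (norm w ^ 6 * norm (z - w) ^ 3)"
        by (simp add: norm_divide norm_mult norm_power)
      also have "\<dots> \<le> 2 * (norm z ^ 4 * (49 * norm w ^ 2)) / (norm w ^ 6 * (norm w / 2) ^ 3)"
      proof (intro frac_le mult_mono power_mono)
        have "norm (15 * w ^ 2 - 24 * z * w + 10 * z ^ 2) \<le> norm (15 * w ^ 2 - 24 * z * w) + norm (10 * z ^ 2)" by (rule norm_triangle_ineq)
        also have "\<dots> \<le> 15 * norm w ^ 2 + 24 * (norm z * norm w) + 10 * norm z ^ 2"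
          using norm_triangle_ineq4[of "15 * w ^ 2" "24 * z * w"] by (simp add: norm_mult norm_power)
        also have "\<dots> \<le> 15 * norm w ^ 2 + 24 * (norm w * norm w) + 10 * norm w ^ 2"
          using nz(2) by (intro add_mono mult_left_mono mult_right_mono power_mono) auto
        finally show "norm (15 * w ^ 2 - 24 * z * w + 10 * z ^ 2) \<le> 49 * norm w ^ 2" by (simp add: power2_eq_square)
      qed (use nz in auto)
      also have "\<dots> = 784 * (norm z ^ 4 * (1 / norm w ^ 7))" using nz(3) by (simp add: field_simps eval_nat_numeral)
      also have "\<dots> \<le> 800 * (norm z ^ 4 * (1 / norm w ^ 7))" by (intro mult_right_mono) auto
      finally show ?thesis by (simp only: mult.assoc)
    qed
    ultimately have "norm (- 2 * (\<Sum>\<^sub>\<infinity>w\<in>L - {0}. 1 / (z - w) ^ 3) - (2 * E 3 + 6 * z * E 4 + 12 * z\<^sup>2 * E 5 + 20 * z ^ 3 * E 6)) \<le> 800 * norm z ^ 4 * M"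
      by (rule norm_infsum_le)
    moreover have "wp' z - (- 2 / z ^ 3 + 2 * a * z + 4 * b * z ^ 3)
        = - 2 * (\<Sum>\<^sub>\<infinity>w\<in>L - {0}. 1 / (z - w) ^ 3) - (2 * E 3 + 6 * z * E 4 + 12 * z\<^sup>2 * E 5 + 20 * z ^ 3 * E 6)"
      unfolding wp'_eq[OF notin[OF z]] by (simp add: E0 ab algebra_simps)
    ultimately show "norm (wp' z - (- 2 / z ^ 3 + 2 * a * z + 4 * b * z ^ 3)) \<le> 800 * M * norm z ^ 4"
      by (simp only: mult_ac)
  qed
qed

text \<open>The error in the Weierstrass equation. The value 0 on the lattice will turn out to be
  its limit there, which makes the lattice points removable singularities.\<close>

definition wp_defect :: "complex \<Rightarrow> complex" where
  "wp_defect z = (if z \<in> L then 0 else (wp' z)\<^sup>2 - 4 * wp w1 w2 z ^ 3 + inv_g2 w1 w2 * wp w1 w2 z + inv_g3 w1 w2)"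

text \<open>The coefficients of z^-6, z^-2 and z^0 cancel: 4 - 4, then -8 a - 12 a + 20 a, then -16
  b - 12 b + 28 b. The normalised errors \<open>u\<close> and \<open>v\<close> are O(z), small
  enough not to disturb this.\<close>

lemma wp_defect_tendsto_0: "(wp_defect \<longlongrightarrow> 0) (at 0)"
proof -
  define a where "a = inv_g2 w1 w2 / 20"
  define b where "b = inv_g3 w1 w2 / 28"
  obtain C d where d: "d > 0" and notin: "\<And>z. norm z < d \<Longrightarrow> z \<notin> L - {0}"
    and u': "\<And>z. norm z < d \<Longrightarrow> norm (wp_reg z - (a * z\<^sup>2 + b * z ^ 4)) \<le> C * norm z ^ 5"
    and v': "\<And>z. norm z < d \<Longrightarrow> norm (wp' z - (- 2 / z ^ 3 + 2 * a * z + 4 * b * z ^ 3)) \<le> C * norm z ^ 4"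
    by (rule wp_expansion[folded a_def b_def]) (rule that)
  define u where "u = (\<lambda>z. (wp_reg z - (a * z\<^sup>2 + b * z ^ 4)) / z ^ 4)"
  define v where "v = (\<lambda>z. (wp' z - (- 2 / z ^ 3 + 2 * a * z + 4 * b * z ^ 3)) / z ^ 3)"
  have ev: "eventually (\<lambda>z. z \<noteq> 0 \<and> norm z < d) (at (0::complex))"
    unfolding eventually_at using d by (intro exI[of _ d]) (auto simp: dist_norm)
  have lim0: "((\<lambda>z::complex. C * norm z) \<longlongrightarrow> 0) (at 0)"
    by (auto intro!: tendsto_eq_intros)
  have u0: "(u \<longlongrightarrow> 0) (at 0)"
  proof (rule Lim_null_comparison[OF eventually_mono[OF ev] lim0])
    fix z :: complex assume z: "z \<noteq> 0 \<and> norm z < d"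
    then have "norm (u z) \<le> C * norm z ^ 5 / norm z ^ 4"
      using u'[of z] by (simp add: u_def norm_divide norm_power divide_right_mono)
    then show "norm (u z) \<le> C * norm z" using z by (simp add: eval_nat_numeral)
  qed
  have v0: "(v \<longlongrightarrow> 0) (at 0)"
  proof (rule Lim_null_comparison[OF eventually_mono[OF ev] lim0])
    fix z :: complex assume z: "z \<noteq> 0 \<and> norm z < d"
    then have "norm (v z) \<le> C * norm z ^ 4 / norm z ^ 3"
      using v'[of z] by (simp add: v_def norm_divide norm_power divide_right_mono)
    then show "norm (v z) \<le> C * norm z" using z by (simp add: eval_nat_numeral)
  qed
  \<comment> \<open>\<open>P\<close> is the numerator of the defect divided by z^6 after the
    cancellations. Each remaining term has a factor \<open>u\<close>, \<open>v\<close> or a positive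
    power of z, and \<open>Y\<close> tends to \<open>a\<close>.\<close>
  define Y where "Y = (\<lambda>z. a + (b + u z) * z\<^sup>2)"
  define P where "P = (\<lambda>z. - 4 * v z - 12 * u z + 4 * a\<^sup>2 * z\<^sup>2 + 4 * a * (4 * b + v z) * z ^ 4
    + (4 * b + v z)\<^sup>2 * z ^ 6 - 12 * z\<^sup>2 * (Y z)\<^sup>2 - 4 * z ^ 6 * Y z ^ 3 + 20 * a * z\<^sup>2 * Y z)"
  have "(P \<longlongrightarrow> 0) (at 0)" unfolding P_def Y_def
    by (auto intro!: tendsto_eq_intros u0 v0)
  moreover have "eventually (\<lambda>z. P z = wp_defect z) (at 0)"
  proof (rule eventually_mono[OF ev])
    fix z :: complex assume z: "z \<noteq> 0 \<and> norm z < d"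
    then have zL: "z \<notin> L" using notin by auto
    define p where "p = 1 + z ^ 4 * Y z"
    define q where "q = - 2 + 2 * a * z ^ 4 + (4 * b + v z) * z ^ 6"
    have p: "wp w1 w2 z = p / z\<^sup>2" using z
      by (simp add: wp_eq p_def Y_def u_def field_simps eval_nat_numeral)
    have q: "wp' z = q / z ^ 3" using z
      by (simp add: q_def v_def field_simps eval_nat_numeral)
    have g: "inv_g2 w1 w2 = 20 * a" "inv_g3 w1 w2 = 28 * b" by (simp_all add: a_def b_def)
    have "wp_defect z = (q\<^sup>2 - 4 * p ^ 3 + 20 * a * z ^ 4 * p + 28 * b * z ^ 6) / z ^ 6"
      unfolding wp_defect_def p q g using zL z by (simp add: field_simps eval_nat_numeral)
    also have "q\<^sup>2 - 4 * p ^ 3 + 20 * a * z ^ 4 * p + 28 * b * z ^ 6 = P z * z ^ 6"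
      unfolding P_def q_def p_def Y_def by algebra
    finally show "P z = wp_defect z" using z by simp
  qed
  ultimately show ?thesis by (rule Lim_transform_eventually)
qed

section \<open>The defect as a bounded entire function\<close>

lemma wp_defect_periodic: "wp_defect (z + w1) = wp_defect z" "wp_defect (z + w2) = wp_defect z"
  using wp_add_period[OF lattice_gen1 half_lattice(1), of z] wp_add_period[OF lattice_gen2 half_lattice(2), of z]
    wp'_add_lattice[OF lattice_gen1, of z] wp'_add_lattice[OF lattice_gen2, of z]
  by (auto simp: wp_defect_def lattice_add_iff lattice_gen1 lattice_gen2)

lemma wp_defect_add_lattice: 
  assumes "v \<in> L"
  shows "wp_defect (z + v) = wp_defect z"
proof -
  interpret p1: periodic_fun_simple wp_defect w1 by unfold_locales (rule wp_defect_periodic)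
  interpret p2: periodic_fun_simple wp_defect w2 by unfold_locales (rule wp_defect_periodic)
  obtain m n where "v = of_int m * w1 + of_int n * w2" using assms unfolding lattice_def by blast
  then have "z + v = (z + of_int m * w1) + of_int n * w2" by simp
  then show ?thesis by (simp only: p1.plus_of_int p2.plus_of_int)
qed

lemma wp_defect_tendsto_lattice:
  assumes "v \<in> L"
  shows "(wp_defect \<longlongrightarrow> 0) (at v)"
proof -
  have "((\<lambda>z. wp_defect (v + z)) \<longlongrightarrow> 0) (at 0)"
    using wp_defect_tendsto_0 wp_defect_add_lattice[OF assms] by (simp add: add.commute)
  then show ?thesis by (simp add: LIM_offset_zero_iff)
qed

lemma holomorphic_wp_defect: "wp_defect holomorphic_on UNIV"
proof -
  have "(\<lambda>z. (wp' z)\<^sup>2 - 4 * wp w1 w2 z ^ 3 + inv_g2 w1 w2 * wp w1 w2 z + inv_g3 w1 w2) holomorphic_on - L"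
    by (intro holomorphic_intros holomorphic_wp holomorphic_wp')
  then have h: "wp_defect holomorphic_on - L"
    by (rule holomorphic_transform) (simp add: wp_defect_def)
  \<comment> \<open>Singularities are removed finitely many at a time, hence the localisation to
    unit balls.\<close>
  have "wp_defect holomorphic_on ball z 1" for z
  proof (rule no_isolated_singularity')
    show "finite (L \<inter> ball z 1)"
    proof (rule finite_subset[OF _ finite_lattice_cball[of "norm z + 1"]], safe)
      fix w assume "w \<in> ball z 1"
      then show "norm w \<le> norm z + 1" using norm_triangle_sub[of w z] by (simp add: dist_norm norm_minus_commute)
    qed
    show "wp_defect holomorphic_on ball z 1 - L \<inter> ball z 1" by (rule holomorphic_on_subset[OF h]) auto
    fix v assume "v \<in> L \<inter> ball z 1"
    then have "(wp_defect \<longlongrightarrow> wp_defect v) (at v)" using wp_defect_tendsto_lattice[of v] by (simp add: wp_defect_def)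
    then show "(wp_defect \<longlongrightarrow> wp_defect v) (at v within ball z 1)" by (rule tendsto_within_subset) simp
  qed auto
  then show ?thesis
    by (meson UNIV_I centre_in_ball holomorphic_on_def field_differentiable_at_within holomorphic_on_imp_differentiable_at open_ball zero_less_one)
qed

lemma complex_coordinates:
  obtains a b :: real where "z = of_real a * w1 + of_real b * w2"
proof
  show "z = of_real (Im (cnj z * w2) / Im (cnj w1 * w2)) * w1 + of_real (Im (cnj w1 * z) / Im (cnj w1 * w2)) * w2"
    using indep by (simp add: complex_eq_iff divide_simps) (simp add: algebra_simps)
qed

text \<open>By periodicity every value is taken on the closed period parallelogram, which is
  compact; taking fractional parts of the coordinates moves a point into it.\<close>

lemma bounded_wp_defect: "bounded (range wp_defect)"
proof -
  define P where "P = (\<lambda>(a, b). of_real a * w1 + of_real b * w2) ` (cbox (0::real) 1 \<times> cbox (0::real) 1)"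
  have "compact P" unfolding P_def case_prod_beta
    by (intro compact_continuous_image compact_Times continuous_intros) auto
  moreover have "continuous_on P wp_defect"
    using holomorphic_on_imp_continuous_on[OF holomorphic_wp_defect] continuous_on_subset by blast
  ultimately have "bounded (wp_defect ` P)" by (intro compact_imp_bounded compact_continuous_image)
  moreover have "range wp_defect \<subseteq> wp_defect ` P"
  proof clarify
    fix z
    obtain a b :: real where z: "z = of_real a * w1 + of_real b * w2" using complex_coordinates .
    define v where "v = of_int \<lfloor>a\<rfloor> * w1 + of_int \<lfloor>b\<rfloor> * w2"
    have "v \<in> L" by (auto simp: v_def lattice_def)
    moreover have zv: "z = (of_real (frac a) * w1 + of_real (frac b) * w2) + v"
      by (simp add: z v_def frac_def algebra_simps)
    ultimately have "wp_defect z = wp_defect (of_real (frac a) * w1 + of_real (frac b) * w2)"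
      using wp_defect_add_lattice by metis
    moreover have "of_real (frac a) * w1 + of_real (frac b) * w2 \<in> P"
      unfolding P_def by (rule image_eqI[of _ _ "(frac a, frac b)"]) (auto simp: frac_lt_1 less_imp_le)
    ultimately show "wp_defect z \<in> wp_defect ` P" by simp
  qed
  ultimately show ?thesis by (rule bounded_subset)
qed

text \<open>Liouville's theorem; the constant is read off at the lattice point 0.\<close>

lemma wp_ode:
  assumes "z \<notin> L"
  shows "(wp' z)\<^sup>2 = 4 * wp w1 w2 z ^ 3 - inv_g2 w1 w2 * wp w1 w2 z - inv_g3 w1 w2"
proof -
  have "wp_defect constant_on UNIV" by (rule Liouville_theorem[OF holomorphic_wp_defect bounded_wp_defect])
  then have "wp_defect z = wp_defect 0" by (auto simp: constant_on_def)
  then show ?thesis using assms lattice_zero by (simp add: wp_defect_def algebra_simps)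
qed

end

section \<open>Inversion of the integral\<close>

lemma isCont_ball_mem:
  fixes f :: "'a :: real_normed_vector \<Rightarrow> 'b :: topological_space"
  assumes "isCont f 0" "open U" "f 0 \<in> U"
  obtains r where "r > 0" "\<And>x. norm x < r \<Longrightarrow> f x \<in> U"
proof -
  obtain T where T: "open T" "0 \<in> T" "\<forall>x\<in>T. f x \<in> U"
    using assms unfolding continuous_at_open by blast
  then obtain r where "r > 0" "ball 0 r \<subseteq> T" using open_contains_ball by blast
  then show ?thesis using T by (intro that[of r]) (auto simp: subset_iff)
qed

lemma isCont_0_of_holomorphic_on_ball:
  assumes "f holomorphic_on ball 0 r" "r > 0"
  shows "isCont f 0"
  by (rule field_differentiable_imp_continuous_at, rule holomorphic_on_imp_differentiable_at[OF assms(1)])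
    (use assms(2) in auto)

text \<open>For s = sin (y/3) with sin y = k t, triplication gives s (3 - 4 s^2) = k t, so the
  expression equals k^2 (1 - t^2).\<close>

definition triple_angle_sextic :: "real \<Rightarrow> complex \<Rightarrow> complex" where
  "triple_angle_sextic k s = of_real k ^ 2 - s\<^sup>2 * (3 - 4 * s\<^sup>2)\<^sup>2"

text \<open>Near 0 the radicand stays close to k^2 > 0, so its principal root is holomorphic and a
  primitive exists on a disc. The derivative 3 / k at 0 is nonzero, whence injectivity.\<close>

lemma cubic_integral_locally_injective:
  assumes "k > 0"
  obtains G e where "e > 0" "G 0 = 0" "inj_on G (ball 0 e)"
    "\<And>s. s \<in> ball 0 e \<Longrightarrow> triple_angle_sextic k s \<notin> \<real>\<^sub>\<le>\<^sub>0"
    "\<And>s. s \<in> ball 0 e \<Longrightarrow> (G has_field_derivative 3 / csqrt (triple_angle_sextic k s)) (at s)"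
proof -
  have "isCont (triple_angle_sextic k) 0" unfolding triple_angle_sextic_def by (intro continuous_intros)
  moreover have "triple_angle_sextic k 0 \<in> - \<real>\<^sub>\<le>\<^sub>0" using assms by (simp add: triple_angle_sextic_def complex_nonpos_Reals_iff)
  ultimately obtain r where r: "r > 0" "\<And>s. norm s < r \<Longrightarrow> triple_angle_sextic k s \<in> - \<real>\<^sub>\<le>\<^sub>0"
    by (rule isCont_ball_mem[OF _ open_Compl[OF closed_nonpos_Reals_complex]]) (rule that)
  let ?g = "\<lambda>s. 3 / csqrt (triple_angle_sextic k s)"
  have "?g holomorphic_on ball 0 r"
    using r(2) unfolding triple_angle_sextic_def by (intro holomorphic_intros) force+
  then obtain H where H: "\<And>s. s \<in> ball 0 r \<Longrightarrow> (H has_field_derivative ?g s) (at s within ball 0 r)"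
    using holomorphic_convex_primitive'[of "ball 0 r" ?g] by (metis convex_ball open_ball)
  define G where "G = (\<lambda>s. H s - H 0)"
  have G: "(G has_field_derivative ?g s) (at s)" if "s \<in> ball 0 r" for s
    using H[OF that] that unfolding G_def by (auto simp: at_within_open[of s "ball 0 r"] intro!: derivative_eq_intros)
  have "deriv G 0 = ?g 0" using G[of 0] r by (intro DERIV_imp_deriv) auto
  then have dnz: "deriv G 0 \<noteq> 0" using assms by (simp add: triple_angle_sextic_def del: of_real_power flip: of_real_power)
  have hol: "G holomorphic_on ball 0 r" using G by (subst holomorphic_on_open) blast+
  obtain e where e: "e > 0" "ball (0::complex) e \<subseteq> ball 0 r" "inj_on G (ball 0 e)"
    by (rule has_complex_derivative_locally_injective[OF hol _ open_ball dnz], use r in simp) (rule that)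
  show ?thesis
  proof (rule that[OF e(1) _ e(3)])
    show "G 0 = 0" by (simp add: G_def)
  qed (use e G r in \<open>auto simp: subset_iff\<close>)
qed

context complex_lattice
begin

text \<open>The derivative of S is the reciprocal of the integrand of G at S, which will make S a
  right inverse of G. To take a root near the double pole, wp + 1/3 is multiplied by z^2; the
  product \<open>V\<close> is holomorphic with value 1 at 0, where the principal branch is
  safe.\<close>

lemma wp_reciprocal_sqrt:
  assumes k: "k > 0"
    and g2: "inv_g2 w1 w2 = of_real (4/27 * (9 - 8 * k^2))"
    and g3: "inv_g3 w1 w2 = of_real (8/27^2 * (8 * k^4 - 36 * k^2 + 27))"
  obtains S r where "r > 0" "S 0 = 0"
    "\<And>z. z \<in> ball 0 r \<Longrightarrow> (S has_field_derivative csqrt (triple_angle_sextic k (S z)) / 3) (at z)"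
    "\<And>z. z \<in> ball 0 r \<Longrightarrow> z \<noteq> 0 \<Longrightarrow> (S z)\<^sup>2 = of_real (k\<^sup>2 / 9) / (wp w1 w2 z + 1/3)"
proof -
  obtain d where d: "d > 0" "\<And>w. w \<in> L \<Longrightarrow> w \<noteq> 0 \<Longrightarrow> d \<le> norm w" using lattice_min_norm by blast
  have notin: "z \<notin> L - {0}" if "z \<in> ball 0 d" for z using that d(2)[of z] by auto
  define V where "V = (\<lambda>z. 1 + z\<^sup>2 * (wp_reg z + 1/3))"
  have "wp_reg holomorphic_on ball 0 d"
    using wp_reg_derivative(3)[OF notin] by (subst holomorphic_on_open) blast+
  then have holV: "V holomorphic_on ball 0 d" unfolding V_def by (intro holomorphic_intros)
  then have "isCont V 0"
    using d(1) by (rule isCont_0_of_holomorphic_on_ball)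
  moreover have V0: "V 0 = 1" by (simp add: V_def)
  then have "V 0 \<in> - \<real>\<^sub>\<le>\<^sub>0" by simp
  ultimately obtain d1 where d1: "d1 > 0" "\<And>z. norm z < d1 \<Longrightarrow> V z \<in> - \<real>\<^sub>\<le>\<^sub>0"
    by (rule isCont_ball_mem[OF _ open_Compl[OF closed_nonpos_Reals_complex]]) (rule that)
  define e where "e = min d d1"
  have e: "e > 0" "e \<le> d" "e \<le> d1" using d d1 by (auto simp: e_def)
  have Vnz: "V z \<notin> \<real>\<^sub>\<le>\<^sub>0" if "z \<in> ball 0 e" for z using d1(2)[of z] that e by auto
  define S where "S = (\<lambda>z. of_real (k / 3) * z / csqrt (V z))"
  have S0: "S 0 = 0" by (simp add: S_def)
  have "V holomorphic_on ball 0 e" by (rule holomorphic_on_subset[OF holV]) (use e in auto)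
  then have holS: "S holomorphic_on ball 0 e" unfolding S_def
    by (intro holomorphic_intros) (use Vnz in force)+
  define P where "P = (\<lambda>z. wp w1 w2 z + 1/3)"
  have VP: "V z = z\<^sup>2 * P z" if "z \<noteq> 0" for z
    using that by (simp add: V_def P_def wp_eq field_simps)
  have Pnz: "P z \<noteq> 0" if "z \<in> ball 0 e" "z \<noteq> 0" for z using VP[of z] Vnz[of z] that by auto
  have SP: "(S z)\<^sup>2 * P z = of_real (k\<^sup>2 / 9)" if "z \<in> ball 0 e" "z \<noteq> 0" for z
    using that Pnz[OF that] by (simp add: S_def power_divide power_mult_distrib VP)
  define T where "T = (\<lambda>z. csqrt (triple_angle_sextic k (S z)) / 3)"
  have dS: "(S has_field_derivative deriv S z) (at z)" if "z \<in> ball 0 e" for z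
    by (rule holomorphic_derivI[OF holS open_ball that])
  have dS0: "deriv S 0 = of_real (k / 3)"
  proof (rule DERIV_imp_deriv)
    have "(V has_field_derivative deriv V 0) (at 0)"
      by (rule holomorphic_derivI[OF holV]) (use d in auto)
    then show "(S has_field_derivative of_real (k / 3)) (at 0)"
      unfolding S_def by (auto intro!: derivative_eq_intros simp: V0)
  qed
  have T0: "T 0 = of_real (k / 3)"
    using k by (simp add: T_def S0 triple_angle_sextic_def del: of_real_power flip: of_real_power)
  \<comment> \<open>At 0 both sides are known outright. Elsewhere, differentiating the constant S^2
    P and inserting \<open>wp_ode\<close> yields the equation, but only for squares.\<close>
  have sq: "(deriv S z)\<^sup>2 = (T z)\<^sup>2" if z: "z \<in> ball 0 e" for z
  proof (cases "z = 0")
    case False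
    define s s' p p' where "s = S z" "s' = deriv S z" "p = P z" "p' = wp' z"
    have zL: "z \<notin> L" using notin[of z] z e False by auto
    have kk: "s\<^sup>2 * p = of_real k ^ 2 / 9" using SP[OF z False] by (simp add: s_s'_p_p'_def)
    have p0: "p \<noteq> 0" using Pnz[OF z False] by (simp add: s_s'_p_p'_def)
    have s0: "s \<noteq> 0" using kk k by auto
    have "((\<lambda>z. (S z)\<^sup>2 * P z) has_field_derivative 2 * s * s' * p + s\<^sup>2 * p') (at z)"
      unfolding P_def s_s'_p_p'_def
      by (rule DERIV_cong, (rule derivative_eq_intros dS[OF z] wp_has_field_derivative[OF zL] refl)+) (simp add: algebra_simps)
    moreover have "((\<lambda>z. (S z)\<^sup>2 * P z) has_field_derivative 0) (at z)"
    proof (rule has_field_derivative_transform_within_open)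
      show "((\<lambda>z. of_real (k\<^sup>2 / 9) :: complex) has_field_derivative 0) (at z)" by simp
      show "of_real (k\<^sup>2 / 9) = (S x)\<^sup>2 * P x" if "x \<in> ball 0 e - {0}" for x using SP[of x] that by simp
    qed (use z False in auto)
    ultimately have "2 * s * s' * p + s\<^sup>2 * p' = 0" by (rule DERIV_unique)
    then have "s * (2 * s' * p) = s * (- (s * p'))" by algebra
    then have e1: "2 * s' * p = - (s * p')" using mult_left_cancel[OF s0] by blast
    have "4 * s'\<^sup>2 * p ^ 3 = (2 * s' * p)\<^sup>2 * p" by (simp add: power_mult_distrib power2_eq_square power3_eq_cube)
    also have "\<dots> = (s\<^sup>2 * p) * p'\<^sup>2" unfolding e1 by (simp add: power_mult_distrib)
    also have "p'\<^sup>2 = 4 * (p - 1/3) ^ 3 - of_real (4/27 * (9 - 8 * k^2)) * (p - 1/3) - of_real (8/27^2 * (8 * k^4 - 36 * k^2 + 27))"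
      using wp_ode[OF zL] unfolding s_s'_p_p'_def P_def g2 g3 by simp
    \<comment> \<open>Replacing s^2 p by K^2 / 9 reduces both sides to polynomials in p and K; they
      agree by the choice of the invariants.\<close>
    also have "s\<^sup>2 * p * \<dots> = 4 * p ^ 3 * (triple_angle_sextic k s / 9)"
    proof -
      define K where "K = complex_of_real k"
      have K: "s\<^sup>2 * p = K\<^sup>2 / 9" using kk by (simp add: K_def)
      have "p ^ 3 * triple_angle_sextic k s = K\<^sup>2 * p ^ 3 - (s\<^sup>2 * p) * (3 * p - 4 * (s\<^sup>2 * p))\<^sup>2"
        unfolding triple_angle_sextic_def K_def by algebra
      also have "\<dots> = K\<^sup>2 * p ^ 3 - K\<^sup>2 / 9 * (3 * p - 4 * (K\<^sup>2 / 9))\<^sup>2" unfolding K ..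
      finally have 1: "4 * p ^ 3 * (triple_angle_sextic k s / 9) = 4/9 * (K\<^sup>2 * p ^ 3 - K\<^sup>2 / 9 * (3 * p - 4 * (K\<^sup>2 / 9))\<^sup>2)"
        by simp
      have 2: "of_real (4/27 * (9 - 8 * k^2)) = 4/27 * (9 - 8 * K^2)" 
        "of_real (8/27^2 * (8 * k^4 - 36 * k^2 + 27)) = 8/27^2 * (8 * K^4 - 36 * K^2 + 27)" by (simp_all add: K_def)
      show ?thesis unfolding 1 2 K by (simp add: field_simps eval_nat_numeral)
    qed
    also have "triple_angle_sextic k s / 9 = (T z)\<^sup>2" by (simp add: T_def s_s'_p_p'_def power_divide)
    finally show ?thesis using p0 by (simp add: s_s'_p_p'_def)
  qed (simp add: dS0 T0)
  have "isCont (deriv S) 0"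
    by (rule isCont_0_of_holomorphic_on_ball[OF holomorphic_deriv[OF holS open_ball] e(1)])
  moreover have "isCont T 0"
  proof -
    have "isCont S 0"
      by (rule isCont_0_of_holomorphic_on_ball[OF holS e(1)])
    then have "isCont (\<lambda>z. triple_angle_sextic k (S z)) 0" unfolding triple_angle_sextic_def by (intro continuous_intros)
    then have "isCont (\<lambda>z. csqrt (triple_angle_sextic k (S z))) 0"
      by (rule isCont_o2[where g = csqrt], intro continuous_within_csqrt)
        (use k in \<open>simp add: triple_angle_sextic_def S0 complex_nonpos_Reals_iff\<close>)
    then show ?thesis unfolding T_def by (intro continuous_intros) auto
  qed
  \<comment> \<open>The sign in \<open>deriv S z = \<plusminus> T z\<close> is fixed by the value \<open>2k/3\<close> of the sum at \<open>0\<close>.\<close>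
  ultimately have "isCont (\<lambda>z. deriv S z + T z) 0" by (intro continuous_intros)
  then obtain r1 where r1: "r1 > 0" "\<And>z. norm z < r1 \<Longrightarrow> deriv S z + T z \<in> - {0}"
    by (rule isCont_ball_mem[of _ "- {0}"]) (use k in \<open>auto simp: dS0 T0\<close>)
  show ?thesis
  proof (rule that[of "min e r1" S])
    show "min e r1 > 0" using e r1 by simp
    fix z :: complex assume z: "z \<in> ball 0 (min e r1)"
    have "(deriv S z - T z) * (deriv S z + T z) = 0" using sq[of z] z by (simp add: power2_eq_square algebra_simps)
    moreover have "deriv S z + T z \<noteq> 0" using r1(2)[of z] z by auto
    ultimately have dT: "deriv S z = T z" by simp
    then show "(S has_field_derivative csqrt (triple_angle_sextic k (S z)) / 3) (at z)"
      using dS[of z, unfolded dT T_def] z by simp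
    show "(S z)\<^sup>2 = of_real (k\<^sup>2 / 9) / (wp w1 w2 z + 1/3)" if "z \<noteq> 0"
      using SP[of z] Pnz[of z] z that unfolding P_def by (subst nonzero_eq_divide_eq) auto
  qed (rule S0)
qed

end

section \<open>The real integral and its comparison with \<open>wp\<close>\<close>

lemma sin_treble_sin: "sin (3 * x) = 3 * sin x - 4 * sin x ^ 3" for x :: real
proof -
  have "sin (3 * x) = sin (2 * x + x)" by simp
  also have "\<dots> = 2 * sin x * cos x * cos x + (1 - 2 * (sin x)\<^sup>2) * sin x"
    by (simp only: sin_add sin_double cos_double_sin)
  also have "\<dots> = 3 * sin x - 4 * sin x ^ 3" using sin_cos_squared_add[of x] by algebra
  finally show ?thesis .
qed

text \<open>G composed with t -> sin (y/3), where y = arcsin (k t), is an antiderivative of the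
  integrand: the inner derivative k cos (y/3) / (3 cos y) times 3 / (k sqrt (1 - t^2)) is the
  trigonometric form of the integrand.\<close>

lemma hyp2F1_cubic_integral:
  fixes k x :: real
  assumes k: "0 < k" "k < 1" and x: "\<bar>x\<bar> < 1"
    and G0: "G 0 = 0"
    and G: "\<And>t. \<bar>t\<bar> \<le> \<bar>x\<bar> \<Longrightarrow> (G has_field_derivative 3 / csqrt (triple_angle_sextic k (of_real (sin (arcsin (k * t) / 3)))))
       (at (of_real (sin (arcsin (k * t) / 3))))"
  shows "G (of_real (sin (arcsin (k * x) / 3))) =
    of_real (LBINT t=0..x. hyp2F1 (1/3) (2/3) (1/2) (k^2 * t^2) / sqrt (1 - t^2))"
proof -
  \<comment> \<open>The closed interval between 0 and \<open>x\<close> for either sign of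
    \<open>x\<close>; the integral is oriented.\<close>
  define I where "I = {min 0 x..max 0 x}"
  have I: "\<bar>t\<bar> \<le> \<bar>x\<bar>" "\<bar>t\<bar> < 1" "\<bar>k * t\<bar> < 1" if "t \<in> I" for t
  proof -
    show *: "\<bar>t\<bar> \<le> \<bar>x\<bar>" "\<bar>t\<bar> < 1" using that x by (auto simp: I_def min_def max_def split: if_splits)
    have "k * \<bar>t\<bar> \<le> 1 * \<bar>t\<bar>" using k by (intro mult_right_mono) auto
    then show "\<bar>k * t\<bar> < 1" using * k by (simp add: abs_mult)
  qed
  define f where "f = (\<lambda>t. cos (arcsin (k * t) / 3) / sqrt (1 - (k * t)\<^sup>2) / sqrt (1 - t\<^sup>2))"
  have sq: "1 - t\<^sup>2 > 0" if "\<bar>t\<bar> < 1" for t :: real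
    using that by (simp add: abs_square_less_1)
  have f: "hyp2F1 (1/3) (2/3) (1/2) (k^2 * t^2) / sqrt (1 - t^2) = f t" if "t \<in> I" for t
  proof -
    have y: "-1 < k * t" "k * t < 1" using I(3)[OF that] by auto
    have "hyp2F1 (1/3) (2/3) (1/2) ((sin (arcsin (k * t)))\<^sup>2) = cos (arcsin (k * t) / 3) / cos (arcsin (k * t))"
      using arcsin_lt_bounded[OF y] by (intro hyp2F1_cubic_trig) auto
    then show ?thesis using y by (simp add: f_def cos_arcsin power_mult_distrib)
  qed
  have "continuous_on I f"
    unfolding f_def using I(2,3) sq[OF I(2)] sq[OF I(3)]
    by (intro continuous_intros) (fastforce simp: abs_less_iff)+
  then have cont: "continuous_on I (\<lambda>t. complex_of_real (f t))" by (intro continuous_intros)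
  have deriv: "((\<lambda>t. G (of_real (sin (arcsin (k * t) / 3)))) has_vector_derivative of_real (f t)) (at t)" if t: "t \<in> I" for t
  proof -
    define s where "s = sin (arcsin (k * t) / 3)"
    have y: "-1 < k * t" "k * t < 1" using I(3)[OF t] by auto
    have "((\<lambda>t. sin (arcsin (k * t) / 3)) has_field_derivative cos (arcsin (k * t) / 3) * (k / sqrt (1 - (k * t)\<^sup>2) / 3)) (at t)"
      using y by (auto intro!: derivative_eq_intros simp: field_simps)
    then have "((\<lambda>t. complex_of_real (sin (arcsin (k * t) / 3))) has_vector_derivative
        of_real (cos (arcsin (k * t) / 3) * (k / sqrt (1 - (k * t)\<^sup>2) / 3))) (at t)"
      by (rule has_vector_derivative_of_real)
    from field_vector_diff_chain_at[OF this G[OF I(1)[OF t]]]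
    have "((\<lambda>t. G (of_real (sin (arcsin (k * t) / 3)))) has_vector_derivative
       of_real (cos (arcsin (k * t) / 3) * (k / sqrt (1 - (k * t)\<^sup>2) / 3)) * (3 / csqrt (triple_angle_sextic k (of_real s)))) (at t)"
      by (simp only: o_def s_def)
    note deriv = this
    have "s * (3 - 4 * s\<^sup>2) = k * t"
      using sin_treble_sin[of "arcsin (k * t) / 3"] y by (simp add: s_def algebra_simps power2_eq_square power3_eq_cube)
    then have "k\<^sup>2 - s\<^sup>2 * (3 - 4 * s\<^sup>2)\<^sup>2 = k\<^sup>2 * (1 - t\<^sup>2)" by algebra
    moreover have "triple_angle_sextic k (of_real s) = of_real (k\<^sup>2 - s\<^sup>2 * (3 - 4 * s\<^sup>2)\<^sup>2)"
      by (simp only: triple_angle_sextic_def of_real_diff of_real_mult of_real_power of_real_numeral)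
    ultimately have "triple_angle_sextic k (of_real s) = of_real (k\<^sup>2 * (1 - t\<^sup>2))" by (simp only:)
    then have "csqrt (triple_angle_sextic k (of_real s)) = of_real (k * sqrt (1 - t\<^sup>2))"
      using k sq[OF I(2)[OF t]] by (simp only: csqrt_of_real) (simp add: csqrt_of_real real_sqrt_mult flip: of_real_mult)
    moreover have "of_real (cos (arcsin (k * t) / 3) * (k / sqrt (1 - (k * t)\<^sup>2) / 3)) * (3 / of_real (k * sqrt (1 - t\<^sup>2)))
       = complex_of_real (f t)"
      using k by (simp add: f_def field_simps)
    ultimately show ?thesis using deriv by simp
  qed
  have "of_real (LBINT t=0..x. hyp2F1 (1/3) (2/3) (1/2) (k^2 * t^2) / sqrt (1 - t^2))
     = (LBINT t=0..x. complex_of_real (hyp2F1 (1/3) (2/3) (1/2) (k^2 * t^2) / sqrt (1 - t^2)))"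
    by (rule interval_lebesgue_integral_of_real[symmetric])
  also have "\<dots> = (LBINT t=ereal 0..ereal x. complex_of_real (f t))"
    by (simp only: zero_ereal_def, rule interval_integral_cong) (use f in \<open>auto simp: I_def einterval_def min_def max_def simp del: of_real_divide split: if_splits\<close>)
  also have "\<dots> = G (of_real (sin (arcsin (k * x) / 3))) - G (of_real (sin (arcsin (k * 0) / 3)))"
    by (rule interval_integral_FTC_finite) (use cont deriv in \<open>auto simp: I_def intro: has_vector_derivative_at_within\<close>)
  finally show ?thesis by (simp add: G0)
qed

text \<open>The point u = 0 is left out because division by zero gives \<open>wp\<close> the value 0
  at its pole: the right-hand side would be 1 - (4/3) k^2 there, and not the limit 1.\<close>

theorem theorem1:
  fixes k :: real and w1 w2 :: complex and phi :: "real \<Rightarrow> real" and \<epsilon> :: real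
  assumes "0 < k" and "k < 1"
    and "Im (cnj w1 * w2) \<noteq> 0"
    and "inv_g2 w1 w2 = of_real (4/27 * (9 - 8 * k^2))"
    and "inv_g3 w1 w2 = of_real (8/27^2 * (8 * k^4 - 36 * k^2 + 27))"
    and "\<epsilon> > 0" and "phi 0 = 0" and "continuous_on {-\<epsilon><..<\<epsilon>} phi"
    and "\<forall>u\<in>{-\<epsilon><..<\<epsilon>}.
           (LBINT t=0..sin (phi u). hyp2F1 (1/3) (2/3) (1/2) (k^2 * t^2) / sqrt (1 - t^2)) = u"
  shows "\<exists>\<delta>>0. \<forall>u::real. 0 < \<bar>u\<bar> \<and> \<bar>u\<bar> < \<delta> \<longrightarrow>
           complex_of_real (1 / hyp2F1 (1/3) (2/3) (1/2) (k^2 * (sin (phi u))^2))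
             = 1 - complex_of_real (4/9 * k^2) / (wp w1 w2 (complex_of_real u) + 1/3)"
proof -
  interpret complex_lattice w1 w2 by unfold_locales (rule assms(3))
  obtain G e where e: "e > 0" and G0: "G 0 = 0" and inj: "inj_on G (ball 0 e)"
    and nz: "\<And>s. s \<in> ball 0 e \<Longrightarrow> triple_angle_sextic k s \<notin> \<real>\<^sub>\<le>\<^sub>0"
    and G: "\<And>s. s \<in> ball 0 e \<Longrightarrow> (G has_field_derivative 3 / csqrt (triple_angle_sextic k s)) (at s)"
    by (rule cubic_integral_locally_injective[OF assms(1)]) (rule that)
  obtain S r where r: "r > 0" and S0: "S 0 = 0"
    and S: "\<And>z. z \<in> ball 0 r \<Longrightarrow> (S has_field_derivative csqrt (triple_angle_sextic k (S z)) / 3) (at z)"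
    and S2: "\<And>z. z \<in> ball 0 r \<Longrightarrow> z \<noteq> 0 \<Longrightarrow> (S z)\<^sup>2 = of_real (k\<^sup>2 / 9) / (wp w1 w2 z + 1/3)"
    by (rule wp_reciprocal_sqrt[OF assms(1,4,5)]) (rule that)
  have "isCont S 0" using S[of 0] r by (auto intro: DERIV_isCont)
  then obtain r1 where r1: "r1 > 0" "\<And>z. norm z < r1 \<Longrightarrow> S z \<in> ball 0 e"
    by (rule isCont_ball_mem[of _ "ball 0 e"]) (use e S0 in auto)
  define R where "R = min r r1"
  have R: "R > 0" using r r1 by (simp add: R_def)
  \<comment> \<open>The derivatives of G at S z and of S at z are reciprocal, so G (S z) - z is
    constant, with value 0 at 0.\<close>
  have GS: "G (S z) = z" if z: "z \<in> ball 0 R" for z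
  proof -
    define h where "h = (\<lambda>z. G (S z) - z)"
    have "(h has_field_derivative 0) (at z within ball 0 R)" if "z \<in> ball 0 R" for z
    proof -
      have Sz: "S z \<in> ball 0 e" "z \<in> ball 0 r" using that r1(2)[of z] by (auto simp: R_def)
      have "csqrt (triple_angle_sextic k (S z)) \<noteq> 0" using nz[OF Sz(1)] by auto
      then have "(h has_field_derivative 0) (at z)" unfolding h_def
        using DERIV_chain2[OF G[OF Sz(1)] S[OF Sz(2)]] by (auto intro!: derivative_eq_intros)
      then show ?thesis by (rule has_field_derivative_at_within)
    qed
    then have "\<exists>c. \<forall>z\<in>ball 0 R. h z = c" by (rule has_field_derivative_zero_constant[OF convex_ball])
    then obtain c where c: "\<And>z. z \<in> ball 0 R \<Longrightarrow> h z = c" by blast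
    then have "h z = h 0" using c[of 0] z R by auto
    then show ?thesis by (simp add: h_def S0 G0)
  qed
  define s where "s = (\<lambda>t. sin (arcsin (k * t) / 3))"
  have "isCont (\<lambda>t. arcsin (k * t)) 0"
    by (rule isCont_o2[where g = arcsin]) (auto intro!: continuous_intros isCont_arcsin)
  then have "isCont (\<lambda>t. complex_of_real (s t)) 0" unfolding s_def by (intro continuous_intros) auto
  then obtain \<eta> where \<eta>: "\<eta> > 0" "\<And>t. norm t < \<eta> \<Longrightarrow> complex_of_real (s t) \<in> ball 0 e"
    by (rule isCont_ball_mem[of _ "ball 0 e"]) (use e in \<open>auto simp: s_def\<close>)
  \<comment> \<open>Continuity with \<open>phi 0 = 0\<close> keeps \<open>sin (phi u)\<close> so
    small that the point s lies in the disc where G is injective, and below 1 in absolute value, as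
    the integral formula requires.\<close>
  have "isCont phi 0" using assms(6,8) by (simp add: continuous_on_interior)
  then have "isCont (\<lambda>u. sin (phi u)) 0" by (intro continuous_intros)
  then obtain \<delta>1 where \<delta>1: "\<delta>1 > 0" "\<And>u. norm u < \<delta>1 \<Longrightarrow> sin (phi u) \<in> ball 0 (min \<eta> 1)"
    by (rule isCont_ball_mem[of _ "ball 0 (min \<eta> 1)"]) (use \<eta> assms(7) in auto)
  show ?thesis
  proof (rule exI[of _ "min (min \<delta>1 \<epsilon>) R"], intro conjI allI impI)
    show "min (min \<delta>1 \<epsilon>) R > 0" using \<delta>1 R assms(6) by simp
    fix u :: real assume u: "0 < \<bar>u\<bar> \<and> \<bar>u\<bar> < min (min \<delta>1 \<epsilon>) R"
    define x where "x = sin (phi u)"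
    have x: "\<bar>x\<bar> < \<eta>" "\<bar>x\<bar> < 1" using \<delta>1(2)[of u] u by (auto simp: x_def)
    have "G (of_real (s x)) = of_real (LBINT t=0..x. hyp2F1 (1/3) (2/3) (1/2) (k^2 * t^2) / sqrt (1 - t^2))"
      unfolding s_def
    proof (rule hyp2F1_cubic_integral[where G = G, OF assms(1,2) x(2) G0])
      fix t assume "\<bar>t\<bar> \<le> \<bar>x\<bar>"
      then have "complex_of_real (s t) \<in> ball 0 e" using \<eta>(2)[of t] x by simp
      from G[OF this] show "(G has_field_derivative 3 / csqrt (triple_angle_sextic k (of_real (sin (arcsin (k * t) / 3)))))
       (at (of_real (sin (arcsin (k * t) / 3))))" by (simp only: s_def)
    qed
    also have "\<dots> = of_real u" using assms(9) u by (simp add: x_def abs_less_iff)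
    also have "\<dots> = G (S (of_real u))" using GS[of "of_real u"] u by simp
    \<comment> \<open>Both points have the image u under G and lie in the disc where G is
      injective.\<close>
    finally have Su: "S (of_real u) = of_real (s x)"
      using inj_onD[OF inj, of "of_real (s x)" "S (of_real u)"] \<eta>(2)[of x] x r1(2)[of "of_real u"] u by (simp add: R_def)
    define y where "y = arcsin (k * x)"
    have "k * \<bar>x\<bar> \<le> 1 * \<bar>x\<bar>" using assms(1,2) by (intro mult_right_mono) auto
    then have "\<bar>k * x\<bar> < 1" using x assms(1) by (simp add: abs_mult)
    then have kx: "-1 < k * x" "k * x < 1" by auto
    then have y: "sin y = k * x" "\<bar>y\<bar> < pi / 2" using arcsin_lt_bounded[OF kx] by (auto simp: y_def)
    have "cos (y / 3) > 0" using y(2) by (intro cos_gt_zero_pi) auto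
    \<comment> \<open>Triplication of the cosine: cos y / cos (y/3) = 4 cos^2 (y/3) - 3 = 1 - 4
      sin^2 (y/3), which is the value of d.\<close>
    moreover have "cos y = cos (y / 3) * (1 - 4 * (sin (y / 3))\<^sup>2)"
    proof -
      have "cos y = 4 * cos (y / 3) ^ 3 - 3 * cos (y / 3)" using cos_treble_cos[of "y / 3"] by simp
      then show ?thesis using sin_cos_squared_add[of "y / 3"] by algebra
    qed
    moreover have "hyp2F1 (1/3) (2/3) (1/2) (k^2 * x^2) = cos (y / 3) / cos y"
      using hyp2F1_cubic_trig[OF y(2)] y(1) by (simp add: power_mult_distrib)
    ultimately have "1 / hyp2F1 (1/3) (2/3) (1/2) (k^2 * x^2) = 1 - 4 * (s x)\<^sup>2"
      by (simp add: s_def y_def[symmetric])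
    then have "complex_of_real (1 / hyp2F1 (1/3) (2/3) (1/2) (k^2 * x^2)) = 1 - 4 * (S (of_real u))\<^sup>2"
      unfolding Su by simp
    also have "\<dots> = 1 - complex_of_real (4/9 * k^2) / (wp w1 w2 (complex_of_real u) + 1/3)"
      using S2[of "of_real u"] u by (simp add: R_def)
    finally show "complex_of_real (1 / hyp2F1 (1/3) (2/3) (1/2) (k^2 * (sin (phi u))^2))
             = 1 - complex_of_real (4/9 * k^2) / (wp w1 w2 (complex_of_real u) + 1/3)"
      by (simp only: x_def)
  qed
qed

end
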